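(* Suppose the ABC assumption (with constants $C,D\ge 0$) and the smoothness assumption (with constant $L$) hold, and let $\{x_t\}$ be generated by FedAvg run for $T\ge 1$ rounds with constant stepsize $\alpha_t=\alpha$ for all $t$, where $\alpha>0$ satisfies $$\alpha\le \min\left\{\sqrt{\frac{n}{Q(C^2+L^2)T}},\ \left(\frac{1}{14Q^3L^2(2C+3L)T}\right)^{1/3},\ \frac1C,\ \frac{1}{2\sqrt{2QCL}}\right\}.$$ Then $$\min_{t=0,1,\ldots,T-1}\mathbb{E}\left[\|\nabla f(x_t)\|^2\right]\le \frac{12(f(x_0)-f^* )}{\alpha QT}+\frac{2\alpha L}{n}\left(D+2C\sigma_f^*\right)+4\alpha^2QL^2D+8\alpha^2L^2Q^2(3L+2C)\sigma_f^*.$$ In addition, if $$\alpha=\frac{1}{\sqrt{\frac{Q(L^2+C^2)T}{n}}+\gamma},\qquad \gamma:=C+\left(14Q^3L^2(2C+3L)T\right)^{1/3}+2\sqrt{2QCL},$$ then $$\min_{t=0,1,\ldots,T-1}\mathbb{E}\left[\|\nabla f(x_t)\|^2\right]=\mathcal{O}\left(\frac{D+C\left(f^*-\frac1n\sum_{i=1}^nf_i^*\right)}{\sqrt{nQT}}+\frac{nD}{T}+\frac{(1+C)\left(f^*-\frac1n\sum_{i=1}^nf_i^*\right)}{T^{2/3}}\right).$$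
   Context: Setting: $n,p,Q\ge 1$ are integers, $[n]=\{1,\ldots,n\}$, $f_i:\mathbb{R}^p\to\mathbb{R}$ for $i\in[n]$, and $f=\frac1n\sum_{i=1}^n f_i$. Notation: $f_i^*:=\inf_x f_i(x)$, $f^*:=\inf_x f(x)$, $\sigma_f^*:=f^*-\frac1n\sum_{i=1}^n f_i^*$; $\|\cdot\|$ is the Euclidean norm. FedAvg: given $x_0\in\mathbb{R}^p$, number of local updates $Q$, and positive stepsizes $\{\alpha_t\}$, in round $t=0,1,\ldots$ each agent $i\in[n]$ sets $x_{i,t}^0=x_t$ and performs, for $\ell=0,\ldots,Q-1$, $x_{i,t}^{\ell+1}=x_{i,t}^\ell-\alpha_t g_i(x_{i,t}^\ell;\xi_{i,t}^\ell)$, where $g_i(x_{i,t}^\ell;\xi_{i,t}^\ell)$ is a stochastic gradient; then $x_{t+1}=\frac1n\sum_{i=1}^n x_{i,t}^Q$. Smoothness assumption: each $f_i$ is $L$-smooth, i.e. $\|\nabla f_i(x)-\nabla f_i(x')\|\le L\|x-x'\|$ for all $x,x'\in\mathbb{R}^p$, and bounded from below, $f_i(x)\ge f_i^*>-\infty$. ABC assumption: there is a filtration $\mathcal{F}_0^0\subset\mathcal{F}_0^1\subset\cdots\subset\mathcal{F}_0^{Q-1}\subset\mathcal{F}_1^0\subset\mathcal{F}_1^1\subset\cdots$ (write $\mathcal{F}_k:=\mathcal{F}_k^0$) to which the process $\{x_{i,k}^\ell: i\in[n],\ 0\le\ell\le Q-1\}$ is adapted, and each $g_i(x_{i,k}^\ell;\xi_{i,k}^\ell)$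 is $\mathcal{F}_{k+1}^\ell$-measurable. There are constants $C,D\ge0$ such that for all $k\in\mathbb{N}$, $i\in[n]$, $\ell\in\{0,\ldots,Q-1\}$, almost surely $\mathbb{E}[g_i(x;\xi_{i,k}^\ell)\mid\mathcal{F}_k^\ell]=\nabla f_i(x)$ and $\mathbb{E}[\|g_i(x;\xi_{i,k}^\ell)-\nabla f_i(x)\|^2\mid\mathcal{F}_k^\ell]\le C[f_i(x)-f_i^*]+D$ (applied in particular at $x=x_{i,k}^\ell$). In addition, the stochastic gradients are independent across different agents at each $k\ge0$. Conventions: expressions such as $1/C$ are read as $+\infty$ when $C=0$. $\mathcal{O}(\cdot)$ denotes the order in $T$ as $T\to\infty$; the suppressed factors do not depend on $T$ and may involve undisplayed quantities such as $L$ and $f(x_0)-f^*$.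
   Formalization: The displayed O-rate is proved when D + Cσ_f* > 0 (it can fail when this is 0, e.g. f = x²/2 with exact gradients); in general the rate is proved with f(x_0) − f* added to the numerators of the first and third terms; the tuned α excludes L = C = 0, where it is undefined. *)

theory Defs
  imports "HOL-Probability.Probability" "HOL-Library.Landau_Symbols"
begin

definition grad :: "('v::real_inner \<Rightarrow> real) \<Rightarrow> 'v \<Rightarrow> 'v" where
  "grad h x = (THE v. GDERIV h x :> v)"

definition L_smooth :: "real \<Rightarrow> ('v::real_inner \<Rightarrow> real) \<Rightarrow> bool" where
  "L_smooth L h \<longleftrightarrow>
     (\<forall>x. GDERIV h x :> grad h x) \<and>
     (\<forall>x x'. norm (grad h x - grad h x') \<le> L * norm (x - x'))"

definition inf_val :: "('v \<Rightarrow> real) \<Rightarrow> real" where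
  "inf_val h = (INF x. h x)"

definition avg_obj :: "nat \<Rightarrow> (nat \<Rightarrow> 'v \<Rightarrow> real) \<Rightarrow> 'v \<Rightarrow> real" where
  "avg_obj n f x = (\<Sum>i=1..n. f i x) / real n"

definition sigma_star :: "nat \<Rightarrow> (nat \<Rightarrow> 'v \<Rightarrow> real) \<Rightarrow> real" where
  "sigma_star n f = inf_val (avg_obj n f) - (\<Sum>i=1..n. inf_val (f i)) / real n"

(* Here s l is the sample used in local update l. *)
primrec local_steps ::
  "real \<Rightarrow> ('v::real_vector \<Rightarrow> 's \<Rightarrow> 'v) \<Rightarrow> (nat \<Rightarrow> 's) \<Rightarrow> 'v \<Rightarrow> nat \<Rightarrow> 'v" where
  "local_steps a h s y 0 = y"
| "local_steps a h s y (Suc l) =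
     local_steps a h s y l - a *\<^sub>R h (local_steps a h s y l) (s l)"

(* One realization of the algorithm: s i t l is the sample drawn by agent i in
   round t at local update l; the random process arises by s i t l = xi i t l omega. *)
primrec fedavg ::
  "nat \<Rightarrow> nat \<Rightarrow> (nat \<Rightarrow> real) \<Rightarrow> (nat \<Rightarrow> 'v::real_vector \<Rightarrow> 's \<Rightarrow> 'v) \<Rightarrow>
   (nat \<Rightarrow> nat \<Rightarrow> nat \<Rightarrow> 's) \<Rightarrow> 'v \<Rightarrow> nat \<Rightarrow> 'v" where
  "fedavg n Q \<alpha> g s x0 0 = x0"
| "fedavg n Q \<alpha> g s x0 (Suc t) =
     (1 / real n) *\<^sub>R (\<Sum>i=1..n. local_steps (\<alpha> t) (g i) (s i t) (fedavg n Q \<alpha> g s x0 t) Q)"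

definition fedavg_local ::
  "nat \<Rightarrow> nat \<Rightarrow> (nat \<Rightarrow> real) \<Rightarrow> (nat \<Rightarrow> 'v::real_vector \<Rightarrow> 's \<Rightarrow> 'v) \<Rightarrow>
   (nat \<Rightarrow> nat \<Rightarrow> nat \<Rightarrow> 's) \<Rightarrow> 'v \<Rightarrow> nat \<Rightarrow> nat \<Rightarrow> nat \<Rightarrow> 'v" where
  "fedavg_local n Q \<alpha> g s x0 i t l =
     local_steps (\<alpha> t) (g i) (s i t) (fedavg n Q \<alpha> g s x0 t) l"

definition vec_cond_exp ::
  "'a measure \<Rightarrow> 'a measure \<Rightarrow> ('a \<Rightarrow> real^'p) \<Rightarrow> 'a \<Rightarrow> real^'p" where
  "vec_cond_exp M F Y \<omega> = (\<chi> j. real_cond_exp M F (\<lambda>\<omega>'. Y \<omega>' $ j) \<omega>)"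

definition cond_indep_vars ::
  "'a measure \<Rightarrow> 'a measure \<Rightarrow> 'i set \<Rightarrow> ('i \<Rightarrow> 'a \<Rightarrow> 'v::topological_space) \<Rightarrow> bool" where
  "cond_indep_vars M F I Y \<longleftrightarrow>
     (\<forall>i\<in>I. Y i \<in> borel_measurable M) \<and>
     (\<forall>J A. J \<subseteq> I \<and> finite J \<and> (\<forall>i\<in>J. A i \<in> sets borel) \<longrightarrow>
        (AE \<omega> in M.
           real_cond_exp M F (indicator {\<omega>'\<in>space M. \<forall>i\<in>J. Y i \<omega>' \<in> A i}) \<omega> =
           (\<Prod>i\<in>J. real_cond_exp M F (indicator {\<omega>'\<in>space M. Y i \<omega>' \<in> A i}) \<omega>)))"

(* Conditional unbiasedness and the variance bound for the oracle h of objective \<phi>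
   at the (possibly random) point X with sample \<zeta>. The second conditional expectation
   is taken in [0, \<infinity>], so the bound also expresses that it is finite. *)
definition abc_at ::
  "'a measure \<Rightarrow> 'a measure \<Rightarrow> real \<Rightarrow> real \<Rightarrow> (real^'p \<Rightarrow> real) \<Rightarrow>
   (real^'p \<Rightarrow> 's \<Rightarrow> real^'p) \<Rightarrow> ('a \<Rightarrow> 's) \<Rightarrow> ('a \<Rightarrow> real^'p) \<Rightarrow> bool" where
  "abc_at M F C D \<phi> h \<zeta> X \<longleftrightarrow>
     (\<lambda>\<omega>. h (X \<omega>) (\<zeta> \<omega>)) \<in> borel_measurable M \<and>
     (AE \<omega> in M. vec_cond_exp M F (\<lambda>\<omega>'. h (X \<omega>') (\<zeta> \<omega>')) \<omega> = grad \<phi> (X \<omega>)) \<and>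
     (AE \<omega> in M.
        nn_cond_exp M F (\<lambda>\<omega>'. ennreal ((norm (h (X \<omega>') (\<zeta> \<omega>') - grad \<phi> (X \<omega>')))\<^sup>2)) \<omega>
          \<le> ennreal (C * (\<phi> (X \<omega>) - inf_val \<phi>) + D))"

(* x i k l is the random local iterate of agent i. The oracle conditions are imposed at
   every fixed point and at the iterates: since the exceptional null set may depend on the
   point, the former alone does not give the latter. Independence across agents is
   conditional on F k l, because the agents' gradients share the random point x_k. *)
definition ABC ::
  "'a measure \<Rightarrow> nat \<Rightarrow> nat \<Rightarrow> (nat \<Rightarrow> real^'p \<Rightarrow> real) \<Rightarrow>
   (nat \<Rightarrow> real^'p \<Rightarrow> 's \<Rightarrow> real^'p) \<Rightarrow> (nat \<Rightarrow> nat \<Rightarrow> nat \<Rightarrow> 'a \<Rightarrow> 's) \<Rightarrow>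
   (nat \<Rightarrow> nat \<Rightarrow> nat \<Rightarrow> 'a \<Rightarrow> real^'p) \<Rightarrow> real \<Rightarrow> real \<Rightarrow> bool" where
  "ABC M n Q f g \<xi> x C D \<longleftrightarrow>
     (\<exists>F :: nat \<Rightarrow> nat \<Rightarrow> 'a measure.
        (\<forall>k. \<forall>l<Q. subalgebra M (F k l)) \<and>
        (\<forall>k l. Suc l < Q \<longrightarrow> subalgebra (F k (Suc l)) (F k l)) \<and>
        (\<forall>k. subalgebra (F (Suc k) 0) (F k (Q - 1))) \<and>
        (\<forall>k. \<forall>i\<in>{1..n}. \<forall>l<Q.
           x i k l \<in> borel_measurable (F k l) \<and>
           (\<lambda>\<omega>. g i (x i k l \<omega>) (\<xi> i k l \<omega>)) \<in> borel_measurable (F (Suc k) l) \<and>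
           (\<forall>y. abc_at M (F k l) C D (f i) (g i) (\<xi> i k l) (\<lambda>_. y)) \<and>
           abc_at M (F k l) C D (f i) (g i) (\<xi> i k l) (x i k l)) \<and>
        (\<forall>k. \<forall>l<Q.
           cond_indep_vars M (F k l) {1..n} (\<lambda>i \<omega>. g i (x i k l \<omega>) (\<xi> i k l \<omega>))))"

(* The value v of an expression with denominator d, read as \<infinity> when d vanishes. *)
definition top_if_zero :: "real \<Rightarrow> real \<Rightarrow> ereal" where
  "top_if_zero d v = (if d = 0 then \<infinity> else ereal v)"

definition stepsize_bound :: "nat \<Rightarrow> nat \<Rightarrow> nat \<Rightarrow> real \<Rightarrow> real \<Rightarrow> ereal" where
  "stepsize_bound n Q T C L =
     Min {top_if_zero (real Q * (C\<^sup>2 + L\<^sup>2) * real T)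
            (sqrt (real n / (real Q * (C\<^sup>2 + L\<^sup>2) * real T))),
          top_if_zero (14 * real Q ^ 3 * L\<^sup>2 * (2 * C + 3 * L) * real T)
            (root 3 (1 / (14 * real Q ^ 3 * L\<^sup>2 * (2 * C + 3 * L) * real T))),
          top_if_zero C (1 / C),
          top_if_zero (2 * sqrt (2 * real Q * C * L)) (1 / (2 * sqrt (2 * real Q * C * L)))}"

definition gamma_const :: "nat \<Rightarrow> nat \<Rightarrow> real \<Rightarrow> real \<Rightarrow> real" where
  "gamma_const Q T C L =
     C + root 3 (14 * real Q ^ 3 * L\<^sup>2 * (2 * C + 3 * L) * real T) + 2 * sqrt (2 * real Q * C * L)"

end

theory Submission
  imports Defs
begin

text \<open>
  In round t the agents move from a common point y to \<open>y - \<alpha> (h + e)\<close>, where h is the sum over local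
  steps of the gradients at the local iterates, averaged over agents, and e the corresponding sum
  of noises.  For \<open>2 \<alpha> L Q \<le> 1\<close>, smoothness and the polarization of \<open>\<langle>\<nabla>f(y), h\<rangle>\<close> give a descent
  inequality: in expectation f decreases by \<open>\<alpha> Q / 2\<close> times \<open>E |\<nabla>f(y)|\<^sup>2\<close>, up to two errors.  One is
  \<open>L \<alpha>\<^sup>2 E |e|\<^sup>2\<close>, the other the client drift \<open>\<Sum>\<^sub>i\<^sub>,\<^sub>l E |x\<^sub>i\<^sup>l - y|\<^sup>2\<close> with weight \<open>\<alpha> L\<^sup>2 / (2 n)\<close>.

  The noises of different local steps are orthogonal because the earlier one is known when the
  later gradient is drawn, and those of different agents at the same step because the gradients are
  conditionally independent (\<open>noise_orthogonal\<close>).  So \<open>E |e|\<^sup>2\<close> is \<open>1 / n\<^sup>2\<close> times a sum of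
  variances.  A variance is bounded by C times a function gap at a local iterate plus D, and such
  a gap is at most twice the gap at y plus L times the squared distance to y
  (\<open>L_smooth_gap_bound\<close>).  The same estimates bound the drift by itself plus quantities at y
  (\<open>drift_le\<close>); under the stepsize condition its own coefficient is small enough to be removed.

  The result (\<open>round_recursion\<close>) is \<open>\<Delta>\<^sub>t\<^sub>+\<^sub>1 \<le> (1 + b) \<Delta>\<^sub>t - (\<alpha> Q / 2) E |\<nabla>f(x\<^sub>t)|\<^sup>2 + N\<close> for the expected
  gap \<open>\<Delta>\<^sub>t = E f(x\<^sub>t) - f\<^sup>*\<close>; the growth b stems from the average gap of the agents, which is
  \<open>\<Delta>\<^sub>t + \<sigma>\<^sup>*\<close>.  The stepsize condition makes \<open>b T\<close> at most \<open>3 / 2\<close>, so that T rounds cost a factor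
  \<open>(1 + b)\<^sup>T \<le> 6\<close> on the initial gap only (\<open>perturbed_recursion_bound\<close>).

  The tuned stepsize is one over a sum that contains each denominator of the stepsize condition,
  and is therefore admissible.  It has exact order \<open>1 / \<surd>T\<close>, and substituting it yields the rates.
\<close>

section \<open>Smooth functions\<close>

lemma GDERIV_unique:
  assumes "GDERIV h x :> u" and "GDERIV h x :> v"
  shows "u = v"
proof -
  have "(\<lambda>w. inner w u) = (\<lambda>w. inner w v)"
    using assms unfolding gderiv_def by (rule has_derivative_unique)
  then have "inner (u - v) u = inner (u - v) v"
    by metis
  then have "inner (u - v) (u - v) = 0"
    by (simp add: inner_diff_right)
  then show ?thesis by simp
qed

lemma grad_eqI: "GDERIV h x :> v \<Longrightarrow> grad h x = v"
  unfolding grad_def by (blast intro: the_equality GDERIV_unique)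

lemma L_smooth_GDERIV: "L_smooth L h \<Longrightarrow> GDERIV h x :> grad h x"
  and L_smooth_lipschitz: "L_smooth L h \<Longrightarrow> norm (grad h x - grad h y) \<le> L * norm (x - y)"
  unfolding L_smooth_def by auto

lemma L_smooth_nonneg:
  fixes h :: "'v::euclidean_space \<Rightarrow> real"
  assumes "L_smooth L h"
  shows "L \<ge> 0"
proof -
  obtain b :: 'v where "b \<in> Basis" using nonempty_Basis by blast
  then have "0 \<le> L * norm (b - 0)"
    using L_smooth_lipschitz[OF assms, of b 0] norm_ge_zero order_trans by blast
  with \<open>b \<in> Basis\<close> show ?thesis by simp
qed

lemma L_smooth_continuous_grad:
  fixes h :: "'v::euclidean_space \<Rightarrow> real"
  assumes "L_smooth L h"
  shows "continuous_on UNIV (grad h)"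
proof -
  have "L-lipschitz_on UNIV (grad h)"
    using L_smooth_lipschitz[OF assms] L_smooth_nonneg[OF assms]
    by (auto intro!: lipschitz_onI simp: dist_norm)
  then show ?thesis by (rule lipschitz_on_continuous_on)
qed

lemma L_smooth_continuous:
  assumes "L_smooth L h"
  shows "continuous_on UNIV h"
  using L_smooth_GDERIV[OF assms] unfolding gderiv_def
  by (meson continuous_at_imp_continuous_on has_derivative_continuous)

text \<open>Along the segment from x to y the function
  \<open>h (x + s d) - s \<langle>\<nabla>h x, d\<rangle> - L s\<^sup>2 |d|\<^sup>2 / 2\<close> of s is nonincreasing, by Cauchy-Schwarz and the
  Lipschitz bound for the gradient.\<close>

lemma L_smooth_upper:
  fixes h :: "'v::euclidean_space \<Rightarrow> real"
  assumes "L_smooth L h"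
  shows "h y \<le> h x + inner (grad h x) (y - x) + L / 2 * (norm (y - x))\<^sup>2"
proof -
  define d where "d = y - x"
  define k where "k s = h (x + s *\<^sub>R d) - s * inner (grad h x) d - L / 2 * s\<^sup>2 * (norm d)\<^sup>2" for s :: real
  have der: "(k has_real_derivative
      (inner d (grad h (x + s *\<^sub>R d)) - inner (grad h x) d - L * s * (norm d)\<^sup>2)) (at s)" for s
  proof -
    have "((\<lambda>s. x + s *\<^sub>R d) has_derivative (\<lambda>u. u *\<^sub>R d)) (at s)"
      by (auto intro!: derivative_eq_intros)
    from has_derivative_compose[OF this L_smooth_GDERIV[OF assms, unfolded gderiv_def]]
    have "((\<lambda>s. h (x + s *\<^sub>R d)) has_derivative
        (\<lambda>u. inner (u *\<^sub>R d) (grad h (x + s *\<^sub>R d)))) (at s)" .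
    then have "((\<lambda>s. h (x + s *\<^sub>R d)) has_real_derivative
        inner d (grad h (x + s *\<^sub>R d))) (at s)"
      by (rule has_derivative_imp_has_field_derivative) simp
    then show ?thesis
      unfolding k_def by (auto intro!: derivative_eq_intros)
  qed
  have "k 1 \<le> k 0"
  proof (rule DERIV_nonpos_imp_nonincreasing[where f = k])
    fix s :: real assume s: "0 \<le> s" "s \<le> 1"
    have "inner d (grad h (x + s *\<^sub>R d)) - inner (grad h x) d
        = inner d (grad h (x + s *\<^sub>R d) - grad h x)"
      by (simp add: inner_diff_right inner_commute)
    also have "\<dots> \<le> norm d * norm (grad h (x + s *\<^sub>R d) - grad h x)"
      by (rule norm_cauchy_schwarz)
    also have "\<dots> \<le> norm d * (L * norm (s *\<^sub>R d))"
      using L_smooth_lipschitz[OF assms, of "x + s *\<^sub>R d" x] by (intro mult_left_mono) auto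
    also have "\<dots> = L * s * (norm d)\<^sup>2"
      using s by (simp add: power2_eq_square)
    finally show "\<exists>y. (k has_real_derivative y) (at s) \<and> y \<le> 0"
      using der by force
  qed simp
  then show ?thesis unfolding k_def d_def by simp
qed

lemma inf_val_le: "bdd_below (range h) \<Longrightarrow> inf_val h \<le> h x"
  unfolding inf_val_def by (simp add: cINF_lower)

text \<open>A gradient step of length \<open>1 / L\<close> cannot pass below the infimum.  A function with
  \<open>L = 0\<close> is affine, and steps of any length are possible; so its gradient vanishes.\<close>

lemma L_smooth_grad_bound:
  fixes h :: "'v::euclidean_space \<Rightarrow> real"
  assumes sm: "L_smooth L h" and bd: "bdd_below (range h)"
  shows "(norm (grad h x))\<^sup>2 \<le> 2 * L * (h x - inf_val h)"
proof -
  let ?g = "grad h x"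
  have step: "s * (norm ?g)\<^sup>2 - L / 2 * s\<^sup>2 * (norm ?g)\<^sup>2 \<le> h x - inf_val h" for s
  proof -
    have "inf_val h \<le> h (x - s *\<^sub>R ?g)" using bd by (rule inf_val_le)
    also have "\<dots> \<le> h x + inner ?g (- (s *\<^sub>R ?g)) + L / 2 * (norm (- (s *\<^sub>R ?g)))\<^sup>2"
      using L_smooth_upper[OF sm, of "x - s *\<^sub>R ?g" x] by simp
    also have "(norm (- (s *\<^sub>R ?g)))\<^sup>2 = s\<^sup>2 * (norm ?g)\<^sup>2"
      by (simp add: power_mult_distrib)
    also have "inner ?g (- (s *\<^sub>R ?g)) = - (s * (norm ?g)\<^sup>2)"
      by (simp add: power2_norm_eq_inner)
    finally show ?thesis by simp
  qed
  show ?thesis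
  proof (cases "L = 0")
    case True
    have "(norm ?g)\<^sup>2 = 0"
    proof (rule ccontr)
      assume "(norm ?g)\<^sup>2 \<noteq> 0"
      then show False
        using step[of "(h x - inf_val h + 1) / (norm ?g)\<^sup>2"] True by simp
    qed
    then show ?thesis using True by simp
  next
    case False
    then have "L > 0" using L_smooth_nonneg[OF sm] by simp
    then show ?thesis using step[of "1 / L"] by (simp add: field_simps power2_eq_square)
  qed
qed

text \<open>By Young's inequality the linear term of the quadratic upper bound is at most
  \<open>|\<nabla>h x|\<^sup>2 / (2 L) + L |y - x|\<^sup>2 / 2\<close>, and the gradient bound turns the first summand into the
  gap at x; for \<open>L = 0\<close> the gradient vanishes.  This is how the variance at a local iterate is compared with the gap at the start of
  the round.\<close>

lemma L_smooth_gap_bound: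
  fixes h :: "'v::euclidean_space \<Rightarrow> real"
  assumes sm: "L_smooth L h" and bd: "bdd_below (range h)"
  shows "h y - inf_val h \<le> 2 * (h x - inf_val h) + L * (norm (y - x))\<^sup>2"
proof -
  have gb: "(norm (grad h x))\<^sup>2 \<le> 2 * L * (h x - inf_val h)"
    by (rule L_smooth_grad_bound[OF sm bd])
  have "inner (grad h x) (y - x) \<le> (h x - inf_val h) + L / 2 * (norm (y - x))\<^sup>2"
  proof (cases "L = 0")
    case True
    then show ?thesis using gb inf_val_le[OF bd, of x] by simp
  next
    case False
    then have L: "L > 0" using L_smooth_nonneg[OF sm] by simp
    have "0 \<le> (norm (grad h x - L *\<^sub>R (y - x)))\<^sup>2" by simp
    also have "\<dots> = (norm (grad h x))\<^sup>2 - 2 * L * inner (grad h x) (y - x) + L\<^sup>2 * (norm (y - x))\<^sup>2"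
      unfolding power2_norm_eq_inner
      by (simp add: inner_diff_left inner_diff_right inner_commute power2_eq_square algebra_simps)
    finally have "2 * L * inner (grad h x) (y - x)
        \<le> 2 * L * ((h x - inf_val h) + L / 2 * (norm (y - x))\<^sup>2)"
      using gb by (simp add: algebra_simps power2_eq_square)
    then show ?thesis using L by simp
  qed
  then show ?thesis using L_smooth_upper[OF sm, of y x] by (simp add: field_simps)
qed

section \<open>The averaged objective\<close>

lemma GDERIV_avg_obj:
  assumes "\<And>i. i \<in> {1..n} \<Longrightarrow> GDERIV (f i) x :> v i"
  shows "GDERIV (avg_obj n f) x :> (1 / real n) *\<^sub>R (\<Sum>i=1..n. v i)"
proof -
  have "((\<lambda>x. (\<Sum>i=1..n. f i x) / real n) has_derivative
      (\<lambda>w. (\<Sum>i=1..n. inner w (v i)) / real n)) (at x)"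
    using assms unfolding gderiv_def
    by (intro bounded_linear.has_derivative[OF bounded_linear_divide] has_derivative_sum)
  then show ?thesis
    unfolding gderiv_def avg_obj_def[abs_def] by (simp add: inner_sum_right)
qed

lemma grad_avg_obj:
  assumes "\<forall>i\<in>{1..n}. L_smooth L (f i)"
  shows "grad (avg_obj n f) x = (1 / real n) *\<^sub>R (\<Sum>i=1..n. grad (f i) x)"
  using assms by (intro grad_eqI GDERIV_avg_obj) (auto intro: L_smooth_GDERIV)

lemma L_smooth_avg_obj:
  fixes f :: "nat \<Rightarrow> 'v::euclidean_space \<Rightarrow> real"
  assumes sm: "\<forall>i\<in>{1..n}. L_smooth L (f i)" and n: "n \<ge> 1"
  shows "L_smooth L (avg_obj n f)"
  unfolding L_smooth_def
proof (intro conjI allI)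
  fix x y :: 'v
  show "GDERIV (avg_obj n f) x :> grad (avg_obj n f) x"
    unfolding grad_avg_obj[OF sm] using sm by (intro GDERIV_avg_obj) (auto intro: L_smooth_GDERIV)
  have "norm (grad (avg_obj n f) x - grad (avg_obj n f) y)
      = norm (\<Sum>i=1..n. grad (f i) x - grad (f i) y) / real n"
    unfolding grad_avg_obj[OF sm]
    by (simp add: sum_subtractf flip: scaleR_diff_right)
  also have "\<dots> \<le> (\<Sum>i=1..n. L * norm (x - y)) / real n"
    using sm by (intro divide_right_mono sum_norm_le) (auto intro: L_smooth_lipschitz)
  also have "\<dots> = L * norm (x - y)" using n by simp
  finally show "norm (grad (avg_obj n f) x - grad (avg_obj n f) y) \<le> L * norm (x - y)" .
qed

lemma avg_inf_val_le:
  assumes "\<forall>i\<in>{1..n}. bdd_below (range (f i))"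
  shows "(\<Sum>i=1..n. inf_val (f i)) / real n \<le> avg_obj n f x"
  unfolding avg_obj_def using assms by (intro divide_right_mono sum_mono) (auto intro: inf_val_le)

lemma bdd_below_avg_obj:
  assumes "\<forall>i\<in>{1..n}. bdd_below (range (f i))"
  shows "bdd_below (range (avg_obj n f))"
  using avg_inf_val_le[OF assms] by (auto intro!: bdd_belowI)

lemma sigma_star_nonneg:
  fixes f :: "nat \<Rightarrow> 'v \<Rightarrow> real"
  assumes "\<forall>i\<in>{1..n}. bdd_below (range (f i))"
  shows "sigma_star n f \<ge> 0"
  unfolding sigma_star_def inf_val_def[of "avg_obj n f"]
  using avg_inf_val_le[OF assms] by (simp add: cINF_greatest)

lemma avg_gap_eq:
  "(\<Sum>i=1..n. f i x - inf_val (f i)) / real n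
     = (avg_obj n f x - inf_val (avg_obj n f)) + sigma_star n f"
  unfolding sigma_star_def avg_obj_def by (simp add: sum_subtractf diff_divide_distrib)

section \<open>Conditional independence\<close>

context finite_measure_subalgebra
begin

lemma integral_mult_real_cond_exp_indicator:
  assumes A: "A \<in> sets M" and A': "A' \<in> sets M"
    and ae: "AE \<omega> in M. real_cond_exp M F (indicator (A \<inter> A')) \<omega>
        = real_cond_exp M F (indicator A) \<omega> * real_cond_exp M F (indicator A') \<omega>"
  shows "integrable M (\<lambda>\<omega>. real_cond_exp M F (indicator A) \<omega> * indicator A' \<omega>)"
    and "(\<integral>\<omega>. real_cond_exp M F (indicator A) \<omega> * indicator A' \<omega> \<partial>M) = measure M (A \<inter> A')"
proof -
  let ?K = "real_cond_exp M F (indicator A)"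
  have int_ind: "integrable M (indicator B :: 'a \<Rightarrow> real)" if "B \<in> sets M" for B
    using that by (intro integrable_real_indicator) (auto simp: emeasure_eq_measure)
  have intK: "integrable M ?K" by (intro real_cond_exp_int int_ind A)
  show int: "integrable M (\<lambda>\<omega>. ?K \<omega> * indicator A' \<omega>)"
    using integrable_mult_indicator[OF A' intK] by (simp add: mult.commute)
  have "(\<integral>\<omega>. ?K \<omega> * indicator A' \<omega> \<partial>M) = (\<integral>\<omega>. ?K \<omega> * real_cond_exp M F (indicator A') \<omega> \<partial>M)"
    by (rule real_cond_exp_intg(2)[symmetric]) (use int A' in auto)
  also have "\<dots> = (\<integral>\<omega>. real_cond_exp M F (indicator (A \<inter> A')) \<omega> \<partial>M)"
    by (rule integral_cong_AE) (use ae in auto)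
  also have "\<dots> = (\<integral>\<omega>. indicator (A \<inter> A') \<omega> \<partial>M)"
    by (intro real_cond_exp_int int_ind sets.Int A A')
  finally show "(\<integral>\<omega>. ?K \<omega> * indicator A' \<omega> \<partial>M) = measure M (A \<inter> A')"
    using A A' by simp
qed

text \<open>As functions of the event for V, both sides of the indicator identity are finite measures;
  so the weight \<open>1\<^sub>A(U)\<close> may be replaced by its conditional expectation in front of every integrable
  function of V.  Self-adjointness of the conditional expectation then moves it to that function.\<close>

lemma set_integral_cond_indep:
  fixes U V :: "'a \<Rightarrow> 'v::topological_space" and h :: "'v \<Rightarrow> real"
  assumes ci: "\<And>A A'. A \<in> sets borel \<Longrightarrow> A' \<in> sets borel \<Longrightarrow>
      AE \<omega> in M. real_cond_exp M F (indicator (U -` A \<inter> space M \<inter> (V -` A' \<inter> space M))) \<omega>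
        = real_cond_exp M F (indicator (U -` A \<inter> space M)) \<omega>
          * real_cond_exp M F (indicator (V -` A' \<inter> space M)) \<omega>"
    and U: "U \<in> borel_measurable M" and V: "V \<in> borel_measurable M"
    and h: "h \<in> borel_measurable borel" and int: "integrable M (\<lambda>\<omega>. h (V \<omega>))"
    and A: "A \<in> sets borel"
  shows "(\<integral>\<omega>. indicator (U -` A \<inter> space M) \<omega> * h (V \<omega>) \<partial>M)
       = (\<integral>\<omega>. indicator (U -` A \<inter> space M) \<omega> * real_cond_exp M F (\<lambda>\<omega>. h (V \<omega>)) \<omega> \<partial>M)"
proof -
  define S where "S = U -` A \<inter> space M"
  have S [measurable]: "S \<in> sets M" unfolding S_def using U A by (rule measurable_sets)
  note [measurable] = V h
  define K where "K = real_cond_exp M F (indicator S)"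
  have K [measurable]: "K \<in> borel_measurable F" "K \<in> borel_measurable M"
    unfolding K_def by auto
  have int_S: "integrable M (indicator S :: 'a \<Rightarrow> real)"
    by (intro integrable_real_indicator) (auto simp: emeasure_eq_measure)
  have K0: "AE \<omega> in M. 0 \<le> K \<omega>" unfolding K_def by (rule real_cond_exp_pos) auto
  have K1: "AE \<omega> in M. K \<omega> \<le> 1"
    unfolding K_def by (rule real_cond_exp_le_c[OF int_S]) (auto simp: indicator_def)
  let ?N1 = "distr (density M (\<lambda>\<omega>. ennreal (indicator S \<omega>))) borel V"
  let ?N2 = "distr (density M (\<lambda>\<omega>. ennreal (K \<omega>))) borel V"
  have "?N1 = ?N2"
  proof (rule measure_eqI)
    fix A' assume "A' \<in> sets ?N1"
    then have A': "A' \<in> sets borel" by simp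
    define S' where "S' = V -` A' \<inter> space M"
    have S' [measurable]: "S' \<in> sets M" unfolding S'_def using V A' by (rule measurable_sets)
    note kk = integral_mult_real_cond_exp_indicator[OF S S'] ci[OF A A', folded S_def S'_def]
    have "emeasure ?N2 A' = (\<integral>\<^sup>+\<omega>. ennreal (K \<omega>) * indicator S' \<omega> \<partial>M)"
      using A' by (simp add: emeasure_distr emeasure_density S'_def)
    also have "\<dots> = (\<integral>\<^sup>+\<omega>. ennreal (K \<omega> * indicator S' \<omega>) \<partial>M)"
      by (intro nn_integral_cong) (auto simp: indicator_def)
    also have "\<dots> = ennreal (\<integral>\<omega>. K \<omega> * indicator S' \<omega> \<partial>M)"
    proof (rule nn_integral_eq_integral)
      show "integrable M (\<lambda>\<omega>. K \<omega> * indicator S' \<omega>)" unfolding K_def using kk by simp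
      show "AE \<omega> in M. 0 \<le> K \<omega> * indicator S' \<omega>" using K0 by eventually_elim simp
    qed
    also have "\<dots> = emeasure M (S \<inter> S')"
      using kk unfolding K_def by (simp add: emeasure_eq_measure)
    also have "\<dots> = (\<integral>\<^sup>+\<omega>. indicator (S \<inter> S') \<omega> \<partial>M)" by simp
    also have "\<dots> = (\<integral>\<^sup>+\<omega>. ennreal (indicator S \<omega>) * indicator S' \<omega> \<partial>M)"
      by (intro nn_integral_cong) (auto simp: indicator_def)
    also have "\<dots> = emeasure ?N1 A'"
      using A' by (simp add: emeasure_distr emeasure_density S'_def)
    finally show "emeasure ?N1 A' = emeasure ?N2 A'" by simp
  qed simp
  then have "(\<integral>x. h x \<partial>?N1) = (\<integral>x. h x \<partial>?N2)" by simp
  moreover have "(\<integral>x. h x \<partial>?N1) = (\<integral>\<omega>. indicator S \<omega> * h (V \<omega>) \<partial>M)"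
    by (simp add: integral_distr integral_density)
  moreover have "(\<integral>x. h x \<partial>?N2) = (\<integral>\<omega>. K \<omega> * h (V \<omega>) \<partial>M)"
    using K0 by (simp add: integral_distr integral_density)
  moreover have intK: "integrable M (\<lambda>\<omega>. K \<omega> * h (V \<omega>))"
  proof (rule Bochner_Integration.integrable_bound[OF int])
    show "AE \<omega> in M. norm (K \<omega> * h (V \<omega>)) \<le> norm (h (V \<omega>))"
      using K0 K1 by eventually_elim (auto simp: abs_mult intro: mult_left_le_one_le)
  qed simp
  moreover have "(\<integral>\<omega>. K \<omega> * h (V \<omega>) \<partial>M)
      = (\<integral>\<omega>. K \<omega> * real_cond_exp M F (\<lambda>\<omega>. h (V \<omega>)) \<omega> \<partial>M)"
    by (rule real_cond_exp_intg(2)[symmetric]) (use intK in auto)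
  moreover have "(\<integral>\<omega>. K \<omega> * real_cond_exp M F (\<lambda>\<omega>. h (V \<omega>)) \<omega> \<partial>M)
      = (\<integral>\<omega>. indicator S \<omega> * real_cond_exp M F (\<lambda>\<omega>. h (V \<omega>)) \<omega> \<partial>M)"
  proof -
    let ?w = "real_cond_exp M F (\<lambda>\<omega>. h (V \<omega>))"
    have "integrable M (\<lambda>\<omega>. ?w \<omega> * indicator S \<omega>)"
      using integrable_mult_indicator[OF S real_cond_exp_int(1)[OF int]] by (simp add: mult.commute)
    then have "(\<integral>\<omega>. ?w \<omega> * K \<omega> \<partial>M) = (\<integral>\<omega>. ?w \<omega> * indicator S \<omega> \<partial>M)"
      unfolding K_def by (intro real_cond_exp_intg(2)) auto
    then show ?thesis by (simp add: mult.commute)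
  qed
  ultimately show ?thesis unfolding S_def by simp
qed

text \<open>Functions of U of the form \<open>1\<^sub>A(U)\<close> determine the conditional expectation given U, and
  therefore \<open>h(V) - E[h(V) | F]\<close> is orthogonal to every function of U.\<close>

lemma integral_cond_indep_mult:
  fixes U V :: "'a \<Rightarrow> 'v::topological_space" and h k :: "'v \<Rightarrow> real"
  assumes ci: "\<And>A A'. A \<in> sets borel \<Longrightarrow> A' \<in> sets borel \<Longrightarrow>
      AE \<omega> in M. real_cond_exp M F (indicator (U -` A \<inter> space M \<inter> (V -` A' \<inter> space M))) \<omega>
        = real_cond_exp M F (indicator (U -` A \<inter> space M)) \<omega>
          * real_cond_exp M F (indicator (V -` A' \<inter> space M)) \<omega>"
    and U: "U \<in> borel_measurable M" and V: "V \<in> borel_measurable M"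
    and h: "h \<in> borel_measurable borel" and int: "integrable M (\<lambda>\<omega>. h (V \<omega>))"
    and k: "k \<in> borel_measurable borel"
    and int_k: "integrable M (\<lambda>\<omega>. k (U \<omega>) * (h (V \<omega>) - real_cond_exp M F (\<lambda>\<omega>. h (V \<omega>)) \<omega>))"
  shows "(\<integral>\<omega>. k (U \<omega>) * (h (V \<omega>) - real_cond_exp M F (\<lambda>\<omega>. h (V \<omega>)) \<omega>) \<partial>M) = 0"
proof -
  define w where "w = (\<lambda>\<omega>. h (V \<omega>) - real_cond_exp M F (\<lambda>\<omega>. h (V \<omega>)) \<omega>)"
  define G where "G = vimage_algebra (space M) U borel"
  have spG: "space G = space M" by (simp add: G_def)
  have setsG: "sets G = {U -` A \<inter> space M | A. A \<in> sets borel}"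
    unfolding G_def by (rule sets_vimage_algebra2) simp
  interpret G: finite_measure_subalgebra M G
    by unfold_locales (use U in \<open>auto simp: subalgebra_def spG setsG intro: measurable_sets\<close>)
  have UG [measurable]: "U \<in> borel_measurable G"
    unfolding G_def by (rule measurable_vimage_algebra1) simp
  have int_w: "integrable M w"
    unfolding w_def by (intro Bochner_Integration.integrable_diff int real_cond_exp_int)
  note [measurable] = k borel_measurable_integrable[OF int_w]
  have ce: "AE \<omega> in M. real_cond_exp M G w \<omega> = 0"
  proof (rule G.real_cond_exp_charact[OF _ int_w])
    fix B assume "B \<in> sets G"
    then obtain A where A: "A \<in> sets borel" and B: "B = U -` A \<inter> space M"
      unfolding setsG by auto
    have BM: "B \<in> sets M" unfolding B using U A by (rule measurable_sets)
    have "(\<integral>\<omega>\<in>B. w \<omega> \<partial>M) = (\<integral>\<omega>. indicator B \<omega> * h (V \<omega>) \<partial>M)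
        - (\<integral>\<omega>. indicator B \<omega> * real_cond_exp M F (\<lambda>\<omega>. h (V \<omega>)) \<omega> \<partial>M)"
      using integrable_mult_indicator[OF BM int]
        integrable_mult_indicator[OF BM real_cond_exp_int(1)[OF int]]
      unfolding set_lebesgue_integral_def w_def by (simp add: right_diff_distrib)
    also have "\<dots> = 0"
      unfolding B by (subst set_integral_cond_indep[OF ci U V h int A]) simp_all
    finally show "(\<integral>\<omega>\<in>B. w \<omega> \<partial>M) = (\<integral>\<omega>\<in>B. 0 \<partial>M)"
      by (simp add: set_lebesgue_integral_def)
  qed auto
  have "(\<integral>\<omega>. k (U \<omega>) * w \<omega> \<partial>M) = (\<integral>\<omega>. k (U \<omega>) * real_cond_exp M G w \<omega> \<partial>M)"
    by (rule G.real_cond_exp_intg(2)[symmetric]) (use int_k int_w in \<open>auto simp: w_def intro: borel_measurable_integrable\<close>)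
  also have "\<dots> = (\<integral>\<omega>. 0 \<partial>M)"
  proof (rule integral_cong_AE)
    show "AE \<omega> in M. k (U \<omega>) * real_cond_exp M G w \<omega> = 0" using ce by eventually_elim simp
  qed (use U in auto)
  finally show ?thesis by (simp add: w_def)
qed

end

lemma cond_indep_vars_pair:
  assumes ci: "cond_indep_vars M F I Y" and ij: "i \<in> I" "j \<in> I" "i \<noteq> j"
    and A: "A \<in> sets borel" "A' \<in> sets borel"
  shows "AE \<omega> in M. real_cond_exp M F (indicator (Y i -` A \<inter> space M \<inter> (Y j -` A' \<inter> space M))) \<omega>
        = real_cond_exp M F (indicator (Y i -` A \<inter> space M)) \<omega>
          * real_cond_exp M F (indicator (Y j -` A' \<inter> space M)) \<omega>"
proof -
  let ?A = "\<lambda>m. if m = i then A else A'"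
  have all: "\<forall>J A. J \<subseteq> I \<and> finite J \<and> (\<forall>i\<in>J. A i \<in> sets borel) \<longrightarrow>
        (AE \<omega> in M.
           real_cond_exp M F (indicator {\<omega>'\<in>space M. \<forall>i\<in>J. Y i \<omega>' \<in> A i}) \<omega> =
           (\<Prod>i\<in>J. real_cond_exp M F (indicator {\<omega>'\<in>space M. Y i \<omega>' \<in> A i}) \<omega>))"
    using ci unfolding cond_indep_vars_def by (rule conjunct2)
  have J: "{i, j} \<subseteq> I \<and> finite {i, j} \<and> (\<forall>m\<in>{i, j}. ?A m \<in> sets borel)"
    using ij A by simp
  have "AE \<omega> in M. real_cond_exp M F (indicator {\<omega>'\<in>space M. \<forall>m\<in>{i, j}. Y m \<omega>' \<in> ?A m}) \<omega> =
      (\<Prod>m\<in>{i, j}. real_cond_exp M F (indicator {\<omega>'\<in>space M. Y m \<omega>' \<in> ?A m}) \<omega>)"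
    by (rule all[THEN spec, THEN spec, THEN mp, OF J])
  moreover have "{\<omega>'\<in>space M. \<forall>m\<in>{i, j}. Y m \<omega>' \<in> ?A m} = Y i -` A \<inter> space M \<inter> (Y j -` A' \<inter> space M)"
    using ij by auto
  moreover have "{\<omega>'\<in>space M. Y m \<omega>' \<in> B} = Y m -` B \<inter> space M" for m B by auto
  ultimately show ?thesis using ij by simp
qed

section \<open>Square-integrable random vectors\<close>

definition sq_integrable :: "'a measure \<Rightarrow> ('a \<Rightarrow> 'v::euclidean_space) \<Rightarrow> bool" where
  "sq_integrable M Y \<longleftrightarrow> Y \<in> borel_measurable M \<and> integrable M (\<lambda>\<omega>. (norm (Y \<omega>))\<^sup>2)"

lemma sq_integrableD:
  assumes "sq_integrable M Y"
  shows "Y \<in> borel_measurable M" and "integrable M (\<lambda>\<omega>. (norm (Y \<omega>))\<^sup>2)"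
  using assms by (auto simp: sq_integrable_def)

lemma norm_add_sq_le: "(norm (u + v))\<^sup>2 \<le> 2 * (norm u)\<^sup>2 + 2 * (norm v)\<^sup>2"
  for u v :: "'v::real_inner"
proof -
  have "0 \<le> (norm (u - v))\<^sup>2" by simp
  then show ?thesis
    by (simp add: power2_norm_eq_inner inner_add_left inner_add_right inner_diff_left
        inner_diff_right inner_commute)
qed

lemma norm_sum_sq_le:
  fixes u :: "'i \<Rightarrow> 'v::real_inner"
  shows "(norm (\<Sum>p\<in>P. u p))\<^sup>2 \<le> real (card P) * (\<Sum>p\<in>P. (norm (u p))\<^sup>2)"
proof -
  have "(norm (\<Sum>p\<in>P. u p))\<^sup>2 \<le> (\<Sum>p\<in>P. norm (u p))\<^sup>2"
    by (intro power_mono norm_sum) simp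
  also have "\<dots> \<le> (\<Sum>p\<in>P. (norm (u p))\<^sup>2) * real (card P)"
    using Cauchy_Schwarz_ineq_sum[of "\<lambda>p. norm (u p)" "\<lambda>_. 1" P] by simp
  finally show ?thesis by (simp add: mult.commute)
qed

lemma sq_integrable_bound:
  assumes "Y \<in> borel_measurable M" and "integrable M k"
    and "\<And>\<omega>. (norm (Y \<omega>))\<^sup>2 \<le> k \<omega>"
  shows "sq_integrable M Y"
  unfolding sq_integrable_def
proof
  show "integrable M (\<lambda>\<omega>. (norm (Y \<omega>))\<^sup>2)"
  proof (rule Bochner_Integration.integrable_bound[OF assms(2)])
    show "AE \<omega> in M. norm ((norm (Y \<omega>))\<^sup>2) \<le> norm (k \<omega>)"
      using assms(3) order_trans[OF _ abs_ge_self] by (intro AE_I2) auto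
  qed (use assms(1) in measurable)
qed (fact assms(1))

lemma sq_integrable_add:
  assumes "sq_integrable M Y" and "sq_integrable M Z"
  shows "sq_integrable M (\<lambda>\<omega>. Y \<omega> + Z \<omega>)"
  using sq_integrableD[OF assms(1)] sq_integrableD[OF assms(2)]
  by (intro sq_integrable_bound[where k = "\<lambda>\<omega>. 2 * (norm (Y \<omega>))\<^sup>2 + 2 * (norm (Z \<omega>))\<^sup>2"])
    (auto intro: norm_add_sq_le)

lemma sq_integrable_scaleR:
  assumes "sq_integrable M Y"
  shows "sq_integrable M (\<lambda>\<omega>. c *\<^sub>R Y \<omega>)"
  using sq_integrableD[OF assms] by (auto simp: sq_integrable_def power_mult_distrib)

lemma sq_integrable_diff:
  assumes "sq_integrable M Y" and "sq_integrable M Z"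
  shows "sq_integrable M (\<lambda>\<omega>. Y \<omega> - Z \<omega>)"
  using sq_integrable_add[OF assms(1) sq_integrable_scaleR[OF assms(2), of "-1"]] by simp

lemma sq_integrable_sum:
  assumes "\<And>p. p \<in> P \<Longrightarrow> sq_integrable M (Y p)"
  shows "sq_integrable M (\<lambda>\<omega>. \<Sum>p\<in>P. Y p \<omega>)"
  using assms
proof (induction P rule: infinite_finite_induct)
  case (insert p P)
  then show ?case by (auto intro: sq_integrable_add)
qed (auto simp: sq_integrable_def)

lemma integrable_inner:
  assumes "sq_integrable M Y" and "sq_integrable M Z"
  shows "integrable M (\<lambda>\<omega>. inner (Y \<omega>) (Z \<omega>))"
proof (rule Bochner_Integration.integrable_bound)
  show "integrable M (\<lambda>\<omega>. (norm (Y \<omega>))\<^sup>2 + (norm (Z \<omega>))\<^sup>2)"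
    using assms by (auto simp: sq_integrable_def)
  show "AE \<omega> in M. norm (inner (Y \<omega>) (Z \<omega>)) \<le> norm ((norm (Y \<omega>))\<^sup>2 + (norm (Z \<omega>))\<^sup>2)"
  proof (rule AE_I2)
    fix \<omega>
    have "\<bar>inner (Y \<omega>) (Z \<omega>)\<bar> \<le> norm (Y \<omega>) * norm (Z \<omega>)"
      by (rule Cauchy_Schwarz_ineq2)
    also have "\<dots> \<le> (norm (Y \<omega>))\<^sup>2 + (norm (Z \<omega>))\<^sup>2"
      using sum_squares_bound[of "norm (Y \<omega>)" "norm (Z \<omega>)"]
        mult_nonneg_nonneg[OF norm_ge_zero norm_ge_zero, of "Y \<omega>" "Z \<omega>"] by linarith
    finally show "norm (inner (Y \<omega>) (Z \<omega>)) \<le> norm ((norm (Y \<omega>))\<^sup>2 + (norm (Z \<omega>))\<^sup>2)"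
      by simp
  qed
qed (use assms in \<open>auto simp: sq_integrable_def\<close>)

lemma borel_measurable_vec_nth [measurable (raw)]:
  fixes Y :: "'a \<Rightarrow> real^'p"
  assumes "Y \<in> borel_measurable M"
  shows "(\<lambda>\<omega>. Y \<omega> $ j) \<in> borel_measurable M"
  using assms by (rule borel_measurable_continuous_on[rotated]) (intro continuous_intros)

lemma sq_integrable_nth:
  fixes Y :: "'a \<Rightarrow> real^'p"
  assumes "sq_integrable M Y"
  shows "sq_integrable M (\<lambda>\<omega>. Y \<omega> $ j)"
proof (rule sq_integrable_bound)
  show "(\<lambda>\<omega>. Y \<omega> $ j) \<in> borel_measurable M"
    using sq_integrableD(1)[OF assms] by simp
  show "(norm (Y \<omega> $ j))\<^sup>2 \<le> (norm (Y \<omega>))\<^sup>2" for \<omega>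
    by (intro power_mono) (simp_all add: component_le_norm_cart)
qed (use sq_integrableD(2)[OF assms] in simp)

lemma integral_norm_sum_orthogonal:
  fixes e :: "'i \<Rightarrow> 'a \<Rightarrow> 'v::euclidean_space"
  assumes "finite P" and sq: "\<And>p. p \<in> P \<Longrightarrow> sq_integrable M (e p)"
    and orth: "\<And>p q. p \<in> P \<Longrightarrow> q \<in> P \<Longrightarrow> p \<noteq> q \<Longrightarrow> (\<integral>\<omega>. inner (e p \<omega>) (e q \<omega>) \<partial>M) = 0"
  shows "(\<integral>\<omega>. (norm (\<Sum>p\<in>P. e p \<omega>))\<^sup>2 \<partial>M) = (\<Sum>p\<in>P. \<integral>\<omega>. (norm (e p \<omega>))\<^sup>2 \<partial>M)"
proof -
  have "(\<integral>\<omega>. (norm (\<Sum>p\<in>P. e p \<omega>))\<^sup>2 \<partial>M) = (\<integral>\<omega>. (\<Sum>p\<in>P. \<Sum>q\<in>P. inner (e p \<omega>) (e q \<omega>)) \<partial>M)"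
    by (simp add: power2_norm_eq_inner inner_sum_left inner_sum_right inner_commute)
  also have "\<dots> = (\<Sum>p\<in>P. \<Sum>q\<in>P. \<integral>\<omega>. inner (e p \<omega>) (e q \<omega>) \<partial>M)"
    using sq by (simp add: integrable_inner)
  also have "\<dots> = (\<Sum>p\<in>P. \<Sum>q\<in>P. if p = q then \<integral>\<omega>. (norm (e p \<omega>))\<^sup>2 \<partial>M else 0)"
    using orth by (intro sum.cong refl) (auto simp: power2_norm_eq_inner)
  also have "\<dots> = (\<Sum>p\<in>P. \<integral>\<omega>. (norm (e p \<omega>))\<^sup>2 \<partial>M)"
    using \<open>finite P\<close> by simp
  finally show ?thesis .
qed

context finite_measure
begin

lemma sq_integrable_const: "sq_integrable M (\<lambda>_. c)"
  by (simp add: sq_integrable_def)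

lemma sq_integrable_imp_integrable:
  fixes Y :: "'a \<Rightarrow> real"
  assumes "sq_integrable M Y"
  shows "integrable M Y"
  using integrable_inner[OF assms sq_integrable_const[of 1]] by simp

lemma sq_integrable_grad:
  assumes sm: "L_smooth L h" and Y: "sq_integrable M Y"
  shows "sq_integrable M (\<lambda>\<omega>. grad h (Y \<omega>))"
proof (rule sq_integrable_bound)
  show "(\<lambda>\<omega>. grad h (Y \<omega>)) \<in> borel_measurable M"
    using sq_integrableD(1)[OF Y] L_smooth_continuous_grad[OF sm]
    by (rule borel_measurable_continuous_on[rotated])
  show "(norm (grad h (Y \<omega>)))\<^sup>2 \<le> 2 * (norm (grad h 0))\<^sup>2 + 2 * (L\<^sup>2 * (norm (Y \<omega>))\<^sup>2)" for \<omega>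
  proof -
    have "(norm (grad h (Y \<omega>) - grad h 0))\<^sup>2 \<le> (L * norm (Y \<omega>))\<^sup>2"
      using L_smooth_lipschitz[OF sm, of "Y \<omega>" 0] by (intro power_mono) auto
    then show ?thesis
      using norm_add_sq_le[of "grad h 0" "grad h (Y \<omega>) - grad h 0"]
      by (simp add: power_mult_distrib)
  qed
qed (use sq_integrableD(2)[OF Y] in simp)

lemma integrable_smooth_comp:
  assumes sm: "L_smooth L h" and bd: "bdd_below (range h)" and Y: "sq_integrable M Y"
  shows "integrable M (\<lambda>\<omega>. h (Y \<omega>))"
proof -
  have "integrable M (\<lambda>\<omega>. h (Y \<omega>) - inf_val h)"
  proof (rule Bochner_Integration.integrable_bound)
    show "integrable M (\<lambda>\<omega>. 2 * (h 0 - inf_val h) + L * (norm (Y \<omega>))\<^sup>2)"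
      using sq_integrableD(2)[OF Y] by simp
    have "(\<lambda>\<omega>. h (Y \<omega>)) \<in> borel_measurable M"
      using sq_integrableD(1)[OF Y] L_smooth_continuous[OF sm]
      by (rule borel_measurable_continuous_on[rotated])
    then show "(\<lambda>\<omega>. h (Y \<omega>) - inf_val h) \<in> borel_measurable M" by simp
    show "AE \<omega> in M. norm (h (Y \<omega>) - inf_val h)
        \<le> norm (2 * (h 0 - inf_val h) + L * (norm (Y \<omega>))\<^sup>2)"
    proof (rule AE_I2)
      fix \<omega>
      show "norm (h (Y \<omega>) - inf_val h) \<le> norm (2 * (h 0 - inf_val h) + L * (norm (Y \<omega>))\<^sup>2)"
        using L_smooth_gap_bound[OF sm bd, of "Y \<omega>" 0] inf_val_le[OF bd, of "Y \<omega>"] by simp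
    qed
  qed
  from Bochner_Integration.integrable_add[OF this integrable_const[of "inf_val h"]]
  show ?thesis by simp
qed

end

context finite_measure_subalgebra
begin

text \<open>The conditional expectation is an orthogonal projection in \<open>L\<^sup>2\<close>.\<close>

lemma integral_inner_cond_exp_diff:
  fixes Y Z V :: "'a \<Rightarrow> real^'p"
  assumes Z: "sq_integrable M Z" "Z \<in> borel_measurable F"
    and Y: "sq_integrable M Y" and V: "sq_integrable M V"
    and ce: "AE \<omega> in M. vec_cond_exp M F Y \<omega> = V \<omega>"
  shows "(\<integral>\<omega>. inner (Z \<omega>) (Y \<omega> - V \<omega>) \<partial>M) = 0"
proof -
  have comp: "(\<integral>\<omega>. Z \<omega> $ j * V \<omega> $ j \<partial>M) = (\<integral>\<omega>. Z \<omega> $ j * Y \<omega> $ j \<partial>M)" for j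
  proof -
    have [measurable]: "(\<lambda>\<omega>. Z \<omega> $ j) \<in> borel_measurable F" using Z(2) by simp
    have [measurable]: "(\<lambda>\<omega>. Y \<omega> $ j) \<in> borel_measurable M" "(\<lambda>\<omega>. V \<omega> $ j) \<in> borel_measurable M"
        "(\<lambda>\<omega>. Z \<omega> $ j) \<in> borel_measurable M"
      using sq_integrable_nth Y V Z(1) sq_integrableD(1) by blast+
    have "integrable M (\<lambda>\<omega>. Z \<omega> $ j * Y \<omega> $ j)"
      using integrable_inner[OF sq_integrable_nth[OF Z(1)] sq_integrable_nth[OF Y]] by simp
    then have "(\<integral>\<omega>. Z \<omega> $ j * real_cond_exp M F (\<lambda>\<omega>. Y \<omega> $ j) \<omega> \<partial>M) = (\<integral>\<omega>. Z \<omega> $ j * Y \<omega> $ j \<partial>M)"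
      by (rule real_cond_exp_intg(2)) auto
    moreover have "(\<integral>\<omega>. Z \<omega> $ j * real_cond_exp M F (\<lambda>\<omega>. Y \<omega> $ j) \<omega> \<partial>M) = (\<integral>\<omega>. Z \<omega> $ j * V \<omega> $ j \<partial>M)"
    proof (rule integral_cong_AE)
      show "AE \<omega> in M. Z \<omega> $ j * real_cond_exp M F (\<lambda>\<omega>. Y \<omega> $ j) \<omega> = Z \<omega> $ j * V \<omega> $ j"
        using ce
      proof eventually_elim
        case (elim \<omega>)
        then show ?case by (metis vec_cond_exp_def vec_lambda_beta)
      qed
    qed measurable
    ultimately show ?thesis by simp
  qed
  have "(\<integral>\<omega>. inner (Z \<omega>) (Y \<omega> - V \<omega>) \<partial>M)
      = (\<integral>\<omega>. (\<Sum>j\<in>UNIV. Z \<omega> $ j * Y \<omega> $ j - Z \<omega> $ j * V \<omega> $ j) \<partial>M)"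
    by (simp add: inner_vec_def right_diff_distrib)
  also have "\<dots> = (\<Sum>j\<in>UNIV. (\<integral>\<omega>. Z \<omega> $ j * Y \<omega> $ j \<partial>M) - (\<integral>\<omega>. Z \<omega> $ j * V \<omega> $ j \<partial>M))"
    using integrable_inner[OF sq_integrable_nth[OF Z(1)] sq_integrable_nth[OF Y]]
      integrable_inner[OF sq_integrable_nth[OF Z(1)] sq_integrable_nth[OF V]]
    by (simp add: Bochner_Integration.integral_diff)
  also have "\<dots> = 0" by (simp add: comp)
  finally show ?thesis .
qed

text \<open>Two agents at the same local step: neither gradient is measurable for the \<open>\<sigma>\<close>-algebra on which
  both are conditioned, so the projection argument does not apply and conditional independence
  has to replace it.\<close>

lemma integral_inner_cond_indep_diff:
  fixes Y :: "'i \<Rightarrow> 'a \<Rightarrow> real^'p"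
  assumes ci: "cond_indep_vars M F I Y" and ij: "i \<in> I" "j \<in> I" "i \<noteq> j"
    and Y: "sq_integrable M (Y i)" "sq_integrable M (Y j)" and V: "sq_integrable M V"
    and ce: "AE \<omega> in M. vec_cond_exp M F (Y j) \<omega> = V \<omega>"
  shows "(\<integral>\<omega>. inner (Y i \<omega>) (Y j \<omega> - V \<omega>) \<partial>M) = 0"
proof -
  note [measurable] = sq_integrableD(1)[OF Y(1)] sq_integrableD(1)[OF Y(2)] sq_integrableD(1)[OF V]
  have int: "integrable M (\<lambda>\<omega>. Y i \<omega> $ m * (Y j \<omega> $ m - V \<omega> $ m))" for m
    using integrable_inner[OF sq_integrable_nth[OF Y(1)]
        sq_integrable_diff[OF sq_integrable_nth[OF Y(2)] sq_integrable_nth[OF V]], of m] by simp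
  have comp: "(\<integral>\<omega>. Y i \<omega> $ m * (Y j \<omega> $ m - V \<omega> $ m) \<partial>M) = 0" for m
  proof -
    let ?w = "real_cond_exp M F (\<lambda>\<omega>. Y j \<omega> $ m)"
    have eq: "AE \<omega> in M. Y i \<omega> $ m * (Y j \<omega> $ m - ?w \<omega>) = Y i \<omega> $ m * (Y j \<omega> $ m - V \<omega> $ m)"
      using ce
    proof eventually_elim
      case (elim \<omega>)
      then show ?case by (metis vec_cond_exp_def vec_lambda_beta)
    qed
    have [measurable]: "(\<lambda>\<omega>. Y l \<omega> $ m) \<in> borel_measurable M" if "l = i \<or> l = j" for l
      using that by auto
    have [measurable]: "(\<lambda>\<omega>. V \<omega> $ m) \<in> borel_measurable M" by simp
    have "(\<integral>\<omega>. Y i \<omega> $ m * (Y j \<omega> $ m - V \<omega> $ m) \<partial>M) = (\<integral>\<omega>. Y i \<omega> $ m * (Y j \<omega> $ m - ?w \<omega>) \<partial>M)"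
      by (rule integral_cong_AE[OF _ _ AE_symmetric[OF eq]]) simp_all
    also have "\<dots> = 0"
    proof (rule integral_cond_indep_mult[of "Y i" "Y j" "\<lambda>v. v $ m" "\<lambda>v. v $ m"])
      show "integrable M (\<lambda>\<omega>. Y j \<omega> $ m)"
        by (intro sq_integrable_imp_integrable sq_integrable_nth Y)
      show "integrable M (\<lambda>\<omega>. Y i \<omega> $ m * (Y j \<omega> $ m - ?w \<omega>))"
        using int[of m] by (subst integrable_cong_AE[OF _ _ eq]) simp_all
    qed (use cond_indep_vars_pair[OF ci ij] in auto)
    finally show ?thesis .
  qed
  have "(\<integral>\<omega>. inner (Y i \<omega>) (Y j \<omega> - V \<omega>) \<partial>M)
      = (\<integral>\<omega>. (\<Sum>m\<in>UNIV. Y i \<omega> $ m * (Y j \<omega> $ m - V \<omega> $ m)) \<partial>M)"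
    by (simp add: inner_vec_def)
  also have "\<dots> = (\<Sum>m\<in>UNIV. \<integral>\<omega>. Y i \<omega> $ m * (Y j \<omega> $ m - V \<omega> $ m) \<partial>M)"
    using int by simp
  also have "\<dots> = 0" by (simp add: comp)
  finally show ?thesis .
qed

lemma nn_integral_nn_cond_exp:
  assumes "h \<in> borel_measurable M"
  shows "(\<integral>\<^sup>+\<omega>. nn_cond_exp M F h \<omega> \<partial>M) = (\<integral>\<^sup>+\<omega>. h \<omega> \<partial>M)"
  using nn_cond_exp_intg[of "\<lambda>_. 1" h] assms by simp

lemma cond_variance_bound:
  fixes E :: "'a \<Rightarrow> real^'p" and b :: "'a \<Rightarrow> real"
  assumes E: "E \<in> borel_measurable M" and b: "integrable M b" "\<And>\<omega>. b \<omega> \<ge> 0"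
    and bound: "AE \<omega> in M. nn_cond_exp M F (\<lambda>\<omega>. ennreal ((norm (E \<omega>))\<^sup>2)) \<omega> \<le> ennreal (b \<omega>)"
  shows "sq_integrable M E" and "(\<integral>\<omega>. (norm (E \<omega>))\<^sup>2 \<partial>M) \<le> (\<integral>\<omega>. b \<omega> \<partial>M)"
proof -
  have "(\<integral>\<^sup>+\<omega>. ennreal ((norm (E \<omega>))\<^sup>2) \<partial>M)
      = (\<integral>\<^sup>+\<omega>. nn_cond_exp M F (\<lambda>\<omega>. ennreal ((norm (E \<omega>))\<^sup>2)) \<omega> \<partial>M)"
    using E by (intro nn_integral_nn_cond_exp[symmetric]) simp
  also have "\<dots> \<le> (\<integral>\<^sup>+\<omega>. ennreal (b \<omega>) \<partial>M)" by (rule nn_integral_mono_AE[OF bound])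
  also have "\<dots> = ennreal (\<integral>\<omega>. b \<omega> \<partial>M)" using b by (intro nn_integral_eq_integral) auto
  finally have le: "(\<integral>\<^sup>+\<omega>. ennreal ((norm (E \<omega>))\<^sup>2) \<partial>M) \<le> ennreal (\<integral>\<omega>. b \<omega> \<partial>M)" .
  have int: "integrable M (\<lambda>\<omega>. (norm (E \<omega>))\<^sup>2)"
    using E le_less_trans[OF le ennreal_less_top] by (intro integrableI_bounded) auto
  then show "sq_integrable M E" using E by (simp add: sq_integrable_def)
  have "ennreal (\<integral>\<omega>. (norm (E \<omega>))\<^sup>2 \<partial>M) \<le> ennreal (\<integral>\<omega>. b \<omega> \<partial>M)"
    using le nn_integral_eq_integral[OF int] by simp
  then show "(\<integral>\<omega>. (norm (E \<omega>))\<^sup>2 \<partial>M) \<le> (\<integral>\<omega>. b \<omega> \<partial>M)"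
    using b(2) by (simp add: integral_nonneg_AE)
qed

end

section \<open>One round of local updates\<close>

text \<open>The round is fixed: y is the common random starting point, \<open>x i l\<close> the iterate of agent i
  after l local steps and \<open>G i l\<close> the stochastic gradient taken there.  The gradients are abstract
  random vectors; the oracle and its samples enter only through their conditional moments and
  their conditional independence.\<close>

locale fedavg_round = prob_space M for M :: "'a measure" +
  fixes n Q :: nat and L C D \<alpha> :: real and f :: "nat \<Rightarrow> real^'p \<Rightarrow> real"
    and F :: "nat \<Rightarrow> 'a measure" and y :: "'a \<Rightarrow> real^'p"
    and x G :: "nat \<Rightarrow> nat \<Rightarrow> 'a \<Rightarrow> real^'p"
  assumes n: "n \<ge> 1" and Q: "Q \<ge> 1" and C: "C \<ge> 0" and D: "D \<ge> 0" and \<alpha>: "\<alpha> > 0"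
    and smooth: "\<forall>i\<in>{1..n}. L_smooth L (f i)"
    and bdd: "\<forall>i\<in>{1..n}. bdd_below (range (f i))"
    and subalg: "\<And>l. l < Q \<Longrightarrow> subalgebra M (F l)"
    and filtration_Suc: "\<And>l. Suc l < Q \<Longrightarrow> subalgebra (F (Suc l)) (F l)"
    and adapted: "\<And>i l. i \<in> {1..n} \<Longrightarrow> l < Q \<Longrightarrow> x i l \<in> borel_measurable (F l)"
    and G_measurable: "\<And>i l. i \<in> {1..n} \<Longrightarrow> l < Q \<Longrightarrow> G i l \<in> borel_measurable M"
    and unbiased: "\<And>i l. i \<in> {1..n} \<Longrightarrow> l < Q \<Longrightarrow>
      AE \<omega> in M. vec_cond_exp M (F l) (G i l) \<omega> = grad (f i) (x i l \<omega>)"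
    and variance: "\<And>i l. i \<in> {1..n} \<Longrightarrow> l < Q \<Longrightarrow>
      AE \<omega> in M. nn_cond_exp M (F l)
          (\<lambda>\<omega>. ennreal ((norm (G i l \<omega> - grad (f i) (x i l \<omega>)))\<^sup>2)) \<omega>
        \<le> ennreal (C * (f i (x i l \<omega>) - inf_val (f i)) + D)"
    and cond_indep: "\<And>l. l < Q \<Longrightarrow> cond_indep_vars M (F l) {1..n} (\<lambda>i. G i l)"
    and start: "\<And>i. i \<in> {1..n} \<Longrightarrow> x i 0 = y" and start_sq: "sq_integrable M y"
    and step: "\<And>i l \<omega>. x i (Suc l) \<omega> = x i l \<omega> - \<alpha> *\<^sub>R G i l \<omega>"
begin

lemma finite_measure_subalgebra_F: "l < Q \<Longrightarrow> finite_measure_subalgebra M (F l)"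
  by (simp add: finite_measure_subalgebra_def finite_measure_subalgebra_axioms_def
      finite_measure_axioms subalg)

lemma filtration_mono:
  assumes "l \<le> m" and "m < Q"
  shows "subalgebra (F m) (F l)"
  using assms
proof (induction m rule: dec_induct)
  case (step m)
  then have "subalgebra (F m) (F l)" "subalgebra (F (Suc m)) (F m)"
    using filtration_Suc by auto
  then show ?case by (auto simp: subalgebra_def)
qed (simp add: subalgebra_def)

lemma L_nonneg: "L \<ge> 0"
  using n smooth L_smooth_nonneg[of L "f 1"] by simp

section \<open>Orthogonality of the noise\<close>

definition noise :: "nat \<Rightarrow> nat \<Rightarrow> 'a \<Rightarrow> real^'p" where
  "noise i l \<omega> = G i l \<omega> - grad (f i) (x i l \<omega>)"

lemma G_eq: "G i l \<omega> = noise i l \<omega> + grad (f i) (x i l \<omega>)"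
  by (simp add: noise_def)

lemma oracle_sq_integrable:
  assumes i: "i \<in> {1..n}" and l: "l < Q" and x: "sq_integrable M (x i l)"
  shows "sq_integrable M (noise i l)" and "sq_integrable M (G i l)"
    and "(\<integral>\<omega>. (norm (noise i l \<omega>))\<^sup>2 \<partial>M) \<le> C * (\<integral>\<omega>. f i (x i l \<omega>) - inf_val (f i) \<partial>M) + D"
proof -
  interpret S: finite_measure_subalgebra M "F l" by (rule finite_measure_subalgebra_F[OF l])
  have sm: "L_smooth L (f i)" and bd: "bdd_below (range (f i))" using smooth bdd i by auto
  have gr: "sq_integrable M (\<lambda>\<omega>. grad (f i) (x i l \<omega>))" by (rule sq_integrable_grad[OF sm x])
  have int: "integrable M (\<lambda>\<omega>. f i (x i l \<omega>))" by (rule integrable_smooth_comp[OF sm bd x])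
  let ?b = "\<lambda>\<omega>. C * (f i (x i l \<omega>) - inf_val (f i)) + D"
  have meas: "noise i l \<in> borel_measurable M"
    unfolding noise_def using G_measurable[OF i l] sq_integrableD(1)[OF gr] by simp
  have b: "integrable M ?b" using int by simp
  have b0: "?b \<omega> \<ge> 0" for \<omega> using C D inf_val_le[OF bd] by simp
  have bound: "AE \<omega> in M. nn_cond_exp M (F l) (\<lambda>\<omega>. ennreal ((norm (noise i l \<omega>))\<^sup>2)) \<omega> \<le> ennreal (?b \<omega>)"
    unfolding noise_def by (rule variance[OF i l])
  show sq: "sq_integrable M (noise i l)" by (rule S.cond_variance_bound(1)[OF meas b b0 bound])
  have "(\<integral>\<omega>. (norm (noise i l \<omega>))\<^sup>2 \<partial>M) \<le> (\<integral>\<omega>. ?b \<omega> \<partial>M)"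
    by (rule S.cond_variance_bound(2)[OF meas b b0 bound])
  also have "\<dots> = C * (\<integral>\<omega>. f i (x i l \<omega>) - inf_val (f i) \<partial>M) + D"
    using int by (simp add: prob_space)
  finally show "(\<integral>\<omega>. (norm (noise i l \<omega>))\<^sup>2 \<partial>M) \<le> C * (\<integral>\<omega>. f i (x i l \<omega>) - inf_val (f i) \<partial>M) + D" .
  show "sq_integrable M (G i l)"
    using sq_integrable_add[OF sq gr] by (simp add: noise_def)
qed

text \<open>Square integrability passes from step to step: a smooth function grows at most quadratically,
  hence the variance bound at a square-integrable iterate is finite.\<close>

lemma x_sq_integrable:
  assumes i: "i \<in> {1..n}" and "l \<le> Q"
  shows "sq_integrable M (x i l)"
  using assms(2)
proof (induction l)
  case 0
  then show ?case using start[OF i] start_sq by simp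
next
  case (Suc l)
  then have "sq_integrable M (x i l)" "sq_integrable M (G i l)"
    using oracle_sq_integrable(2)[OF i] by auto
  then show ?case
    unfolding step[abs_def] by (intro sq_integrable_diff sq_integrable_scaleR)
qed

lemma x_sq [intro]: "i \<in> {1..n} \<Longrightarrow> l < Q \<Longrightarrow> sq_integrable M (x i l)"
  and G_sq [intro]: "i \<in> {1..n} \<Longrightarrow> l < Q \<Longrightarrow> sq_integrable M (G i l)"
  and noise_sq [intro]: "i \<in> {1..n} \<Longrightarrow> l < Q \<Longrightarrow> sq_integrable M (noise i l)"
  using x_sq_integrable oracle_sq_integrable by auto

lemma grad_sq [intro]:
  "i \<in> {1..n} \<Longrightarrow> sq_integrable M Y \<Longrightarrow> sq_integrable M (\<lambda>\<omega>. grad (f i) (Y \<omega>))"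
  using smooth sq_integrable_grad by blast

lemma value_integrable [intro]:
  "i \<in> {1..n} \<Longrightarrow> sq_integrable M Y \<Longrightarrow> integrable M (\<lambda>\<omega>. f i (Y \<omega>))"
  using smooth bdd integrable_smooth_comp by blast

lemma noise_orthogonal_past:
  assumes i: "i \<in> {1..n}" and l: "l < Q"
    and Z: "sq_integrable M Z" "Z \<in> borel_measurable (F l)"
  shows "(\<integral>\<omega>. inner (Z \<omega>) (noise i l \<omega>) \<partial>M) = 0"
proof -
  interpret S: finite_measure_subalgebra M "F l" by (rule finite_measure_subalgebra_F[OF l])
  show ?thesis
    unfolding noise_def
    using S.integral_inner_cond_exp_diff[OF Z G_sq[OF i l] grad_sq[OF i x_sq[OF i l]] unbiased[OF i l]] .
qed

lemma grad_x_measurable: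
  assumes i: "i \<in> {1..n}" and l: "l < Q"
  shows "(\<lambda>\<omega>. grad (f i) (x i l \<omega>)) \<in> borel_measurable (F l)"
  by (intro borel_measurable_continuous_on[of "grad (f i)"] adapted[OF i l]
      L_smooth_continuous_grad[of L] bspec[OF smooth i])

text \<open>A local gradient can be read off from two consecutive iterates, and so it is known at the next
  local step already, not only in the next round.\<close>

lemma noise_measurable:
  assumes i: "i \<in> {1..n}" and l: "Suc l < Q"
  shows "noise i l \<in> borel_measurable (F (Suc l))"
proof -
  have l': "l < Q" using l by simp
  have gr: "(\<lambda>\<omega>. grad (f i) (x i l \<omega>)) \<in> borel_measurable (F (Suc l))"
    by (rule measurable_from_subalg[OF filtration_Suc[OF l] grad_x_measurable[OF i l']])
  have "x i l \<in> borel_measurable (F (Suc l))"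
    by (rule measurable_from_subalg[OF filtration_Suc[OF l] adapted[OF i l']])
  moreover have "x i (Suc l) \<in> borel_measurable (F (Suc l))" using adapted[OF i l] .
  ultimately have "(\<lambda>\<omega>. (1 / \<alpha>) *\<^sub>R (x i l \<omega> - x i (Suc l) \<omega>)) \<in> borel_measurable (F (Suc l))"
    by simp
  moreover have "(1 / \<alpha>) *\<^sub>R (x i l \<omega> - x i (Suc l) \<omega>) = G i l \<omega>" for \<omega>
    using \<alpha> by (simp add: step)
  ultimately show ?thesis unfolding noise_def using gr by simp
qed

text \<open>The earlier noise is known when the later gradient is drawn.\<close>

lemma noise_orthogonal_later:
  assumes i: "i \<in> {1..n}" and j: "j \<in> {1..n}" and "l < m" and m: "m < Q"
  shows "(\<integral>\<omega>. inner (noise i l \<omega>) (noise j m \<omega>) \<partial>M) = 0"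
proof (rule noise_orthogonal_past[OF j m])
  show "sq_integrable M (noise i l)" using assms by auto
  show "noise i l \<in> borel_measurable (F m)"
    using measurable_from_subalg[OF filtration_mono noise_measurable[OF i]] assms by simp
qed

lemma noise_orthogonal_agents:
  assumes i: "i \<in> {1..n}" and j: "j \<in> {1..n}" and "i \<noteq> j" and l: "l < Q"
  shows "(\<integral>\<omega>. inner (noise i l \<omega>) (noise j l \<omega>) \<partial>M) = 0"
proof -
  interpret S: finite_measure_subalgebra M "F l" by (rule finite_measure_subalgebra_F[OF l])
  have "(\<integral>\<omega>. inner (G i l \<omega>) (noise j l \<omega>) \<partial>M) = 0"
    unfolding noise_def
    by (rule S.integral_inner_cond_indep_diff[OF cond_indep[OF l] i j \<open>i \<noteq> j\<close> G_sq[OF i l]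
          G_sq[OF j l] grad_sq[OF j x_sq[OF j l]] unbiased[OF j l]])
  moreover have "(\<integral>\<omega>. inner (grad (f i) (x i l \<omega>)) (noise j l \<omega>) \<partial>M) = 0"
    by (rule noise_orthogonal_past[OF j l grad_sq[OF i x_sq[OF i l]] grad_x_measurable[OF i l]])
  moreover have "(\<integral>\<omega>. inner (noise i l \<omega>) (noise j l \<omega>) \<partial>M)
      = (\<integral>\<omega>. inner (G i l \<omega>) (noise j l \<omega>) \<partial>M)
        - (\<integral>\<omega>. inner (grad (f i) (x i l \<omega>)) (noise j l \<omega>) \<partial>M)"
    unfolding noise_def[of i] inner_diff_left
    by (intro Bochner_Integration.integral_diff integrable_inner G_sq noise_sq
        grad_sq x_sq i j l)
  ultimately show ?thesis by simp
qed

lemma noise_orthogonal: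
  assumes "p \<in> {1..n} \<times> {..<Q}" and "q \<in> {1..n} \<times> {..<Q}" and "p \<noteq> q"
  shows "(\<integral>\<omega>. inner (noise (fst p) (snd p) \<omega>) (noise (fst q) (snd q) \<omega>) \<partial>M) = 0"
proof -
  consider "snd p < snd q" | "snd q < snd p" | "snd p = snd q" "fst p \<noteq> fst q"
    using \<open>p \<noteq> q\<close> by (metis linorder_neqE_nat prod.collapse)
  then show ?thesis
  proof cases
    case 1
    then show ?thesis using assms by (intro noise_orthogonal_later) auto
  next
    case 2
    then show ?thesis
      using assms by (subst inner_commute, intro noise_orthogonal_later) auto
  next
    case 3
    then show ?thesis using assms noise_orthogonal_agents[of "fst p" "fst q" "snd p"] by auto
  qed
qed

section \<open>Client drift\<close>

definition gap :: "nat \<Rightarrow> real" where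
  "gap i = (\<integral>\<omega>. f i (y \<omega>) - inf_val (f i) \<partial>M)"

definition dev :: "nat \<Rightarrow> nat \<Rightarrow> real" where
  "dev i l = (\<integral>\<omega>. (norm (x i l \<omega> - y \<omega>))\<^sup>2 \<partial>M)"

definition drift :: "nat \<Rightarrow> real" where
  "drift i = (\<Sum>l<Q. dev i l)"

lemma gap_nonneg: "i \<in> {1..n} \<Longrightarrow> gap i \<ge> 0"
  unfolding gap_def using bdd inf_val_le by (intro integral_nonneg_AE AE_I2) fastforce

lemma dev_nonneg: "dev i l \<ge> 0"
  unfolding dev_def by simp

lemma drift_nonneg: "drift i \<ge> 0"
  unfolding drift_def by (simp add: sum_nonneg dev_nonneg)

lemma x_dev_integrable [intro]:
  "i \<in> {1..n} \<Longrightarrow> l < Q \<Longrightarrow> integrable M (\<lambda>\<omega>. (norm (x i l \<omega> - y \<omega>))\<^sup>2)"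
  using sq_integrableD(2)[OF sq_integrable_diff[OF x_sq start_sq]] .

lemma local_gap_le:
  assumes i: "i \<in> {1..n}" and l: "l < Q"
  shows "(\<integral>\<omega>. f i (x i l \<omega>) - inf_val (f i) \<partial>M) \<le> 2 * gap i + L * dev i l"
proof -
  have int: "integrable M (\<lambda>\<omega>. f i (x i l \<omega>))" "integrable M (\<lambda>\<omega>. f i (y \<omega>))"
    using value_integrable[OF i x_sq[OF i l]] value_integrable[OF i start_sq] by auto
  have "(\<integral>\<omega>. f i (x i l \<omega>) - inf_val (f i) \<partial>M)
      \<le> (\<integral>\<omega>. 2 * (f i (y \<omega>) - inf_val (f i)) + L * (norm (x i l \<omega> - y \<omega>))\<^sup>2 \<partial>M)"
    using int x_dev_integrable[OF i l] smooth bdd i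
    by (intro integral_mono L_smooth_gap_bound) auto
  also have "\<dots> = 2 * gap i + L * dev i l"
    unfolding gap_def dev_def using int x_dev_integrable[OF i l] by (simp add: prob_space)
  finally show ?thesis .
qed

lemma noise_variance_le:
  assumes i: "i \<in> {1..n}" and l: "l < Q"
  shows "(\<integral>\<omega>. (norm (noise i l \<omega>))\<^sup>2 \<partial>M) \<le> 2 * C * gap i + D + C * L * dev i l"
proof -
  have "(\<integral>\<omega>. (norm (noise i l \<omega>))\<^sup>2 \<partial>M) \<le> C * (\<integral>\<omega>. f i (x i l \<omega>) - inf_val (f i) \<partial>M) + D"
    using oracle_sq_integrable(3)[OF i l x_sq[OF i l]] .
  also have "\<dots> \<le> C * (2 * gap i + L * dev i l) + D"
    using local_gap_le[OF i l] C by (intro add_right_mono mult_left_mono) auto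
  finally show ?thesis by (simp add: algebra_simps)
qed

lemma local_grad_sq_le:
  assumes i: "i \<in> {1..n}" and l: "l < Q"
  shows "(\<integral>\<omega>. (norm (grad (f i) (x i l \<omega>)))\<^sup>2 \<partial>M) \<le> 4 * L * gap i + 2 * L\<^sup>2 * dev i l"
proof -
  have sm: "L_smooth L (f i)" and bd: "bdd_below (range (f i))" using smooth bdd i by auto
  have int: "integrable M (\<lambda>\<omega>. f i (y \<omega>))" by (rule value_integrable[OF i start_sq])
  have "(\<integral>\<omega>. (norm (grad (f i) (x i l \<omega>)))\<^sup>2 \<partial>M)
      \<le> (\<integral>\<omega>. 4 * L * (f i (y \<omega>) - inf_val (f i)) + 2 * L\<^sup>2 * (norm (x i l \<omega> - y \<omega>))\<^sup>2 \<partial>M)"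
  proof (intro integral_mono)
    fix \<omega>
    have "(norm (grad (f i) (x i l \<omega>) - grad (f i) (y \<omega>)))\<^sup>2 \<le> (L * norm (x i l \<omega> - y \<omega>))\<^sup>2"
      by (intro power_mono L_smooth_lipschitz[OF sm]) simp
    then show "(norm (grad (f i) (x i l \<omega>)))\<^sup>2
        \<le> 4 * L * (f i (y \<omega>) - inf_val (f i)) + 2 * L\<^sup>2 * (norm (x i l \<omega> - y \<omega>))\<^sup>2"
      using norm_add_sq_le[of "grad (f i) (y \<omega>)" "grad (f i) (x i l \<omega>) - grad (f i) (y \<omega>)"]
        L_smooth_grad_bound[OF sm bd, of "y \<omega>"]
      by (simp add: power_mult_distrib)
  qed (use int x_dev_integrable[OF i l] sq_integrableD(2)[OF grad_sq[OF i x_sq[OF i l]]] in auto)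
  also have "\<dots> = 4 * L * gap i + 2 * L\<^sup>2 * dev i l"
    unfolding gap_def dev_def using int x_dev_integrable[OF i l] by (simp add: prob_space)
  finally show ?thesis .
qed

lemma x_minus_start:
  assumes "i \<in> {1..n}"
  shows "x i l \<omega> - y \<omega> = - \<alpha> *\<^sub>R (\<Sum>j<l. G i j \<omega>)"
proof (induction l)
  case (Suc l)
  then show ?case by (simp add: step algebra_simps)
qed (simp add: start[OF assms])

text \<open>Only the noise part profits from orthogonality; the true gradients along the local path may
  all point in the same direction, and their sum costs the factor l.\<close>

lemma dev_le:
  assumes i: "i \<in> {1..n}" and l: "l \<le> Q"
  shows "dev i l \<le> 2 * \<alpha>\<^sup>2 * (\<Sum>j<l. \<integral>\<omega>. (norm (noise i j \<omega>))\<^sup>2 \<partial>M)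
      + 2 * \<alpha>\<^sup>2 * real l * (\<Sum>j<l. \<integral>\<omega>. (norm (grad (f i) (x i j \<omega>)))\<^sup>2 \<partial>M)"
proof -
  let ?N = "\<lambda>\<omega>. \<Sum>j<l. noise i j \<omega>"
  have sqN: "sq_integrable M ?N" using i l by (intro sq_integrable_sum) auto
  have intg: "integrable M (\<lambda>\<omega>. (norm (grad (f i) (x i j \<omega>)))\<^sup>2)" if "j < l" for j
    using sq_integrableD(2)[OF grad_sq[OF i x_sq[OF i]]] that l by simp
  have "dev i l \<le> (\<integral>\<omega>. 2 * \<alpha>\<^sup>2 * (norm (?N \<omega>))\<^sup>2
      + 2 * \<alpha>\<^sup>2 * real l * (\<Sum>j<l. (norm (grad (f i) (x i j \<omega>)))\<^sup>2) \<partial>M)"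
    unfolding dev_def
  proof (rule integral_mono)
    show "integrable M (\<lambda>\<omega>. (norm (x i l \<omega> - y \<omega>))\<^sup>2)"
      using sq_integrableD(2)[OF sq_integrable_diff[OF x_sq_integrable[OF i l] start_sq]] .
    show "integrable M (\<lambda>\<omega>. 2 * \<alpha>\<^sup>2 * (norm (?N \<omega>))\<^sup>2
      + 2 * \<alpha>\<^sup>2 * real l * (\<Sum>j<l. (norm (grad (f i) (x i j \<omega>)))\<^sup>2))"
      using sq_integrableD(2)[OF sqN] intg
      by (intro Bochner_Integration.integrable_add integrable_mult_right Bochner_Integration.integrable_sum) auto
    fix \<omega>
    let ?H = "\<Sum>j<l. grad (f i) (x i j \<omega>)"
    have "(norm (x i l \<omega> - y \<omega>))\<^sup>2 = \<alpha>\<^sup>2 * (norm (?N \<omega> + ?H))\<^sup>2"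
      by (simp add: x_minus_start[OF i] G_eq sum.distrib power_mult_distrib)
    also have "\<dots> \<le> \<alpha>\<^sup>2 * (2 * (norm (?N \<omega>))\<^sup>2 + 2 * (norm ?H)\<^sup>2)"
      by (intro mult_left_mono norm_add_sq_le) simp
    also have "\<dots> \<le> \<alpha>\<^sup>2 * (2 * (norm (?N \<omega>))\<^sup>2
        + 2 * (real l * (\<Sum>j<l. (norm (grad (f i) (x i j \<omega>)))\<^sup>2)))"
      using norm_sum_sq_le[of "\<lambda>j. grad (f i) (x i j \<omega>)" "{..<l}"]
      by (intro mult_left_mono add_left_mono) auto
    finally show "(norm (x i l \<omega> - y \<omega>))\<^sup>2 \<le> 2 * \<alpha>\<^sup>2 * (norm (?N \<omega>))\<^sup>2
        + 2 * \<alpha>\<^sup>2 * real l * (\<Sum>j<l. (norm (grad (f i) (x i j \<omega>)))\<^sup>2)"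
      by (simp add: algebra_simps)
  qed
  also have "\<dots> = 2 * \<alpha>\<^sup>2 * (\<integral>\<omega>. (norm (?N \<omega>))\<^sup>2 \<partial>M)
      + 2 * \<alpha>\<^sup>2 * real l * (\<Sum>j<l. \<integral>\<omega>. (norm (grad (f i) (x i j \<omega>)))\<^sup>2 \<partial>M)"
  proof -
    have "(\<integral>\<omega>. (\<Sum>j<l. (norm (grad (f i) (x i j \<omega>)))\<^sup>2) \<partial>M)
        = (\<Sum>j<l. \<integral>\<omega>. (norm (grad (f i) (x i j \<omega>)))\<^sup>2 \<partial>M)"
      using intg by (intro Bochner_Integration.integral_sum) auto
    moreover have "integrable M (\<lambda>\<omega>. \<Sum>j<l. (norm (grad (f i) (x i j \<omega>)))\<^sup>2)"
      using intg by (intro Bochner_Integration.integrable_sum) auto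
    ultimately show ?thesis using sq_integrableD(2)[OF sqN] by simp
  qed
  also have "(\<integral>\<omega>. (norm (?N \<omega>))\<^sup>2 \<partial>M) = (\<Sum>j<l. \<integral>\<omega>. (norm (noise i j \<omega>))\<^sup>2 \<partial>M)"
    using i l noise_orthogonal[of "(i, _)" "(i, _)"]
    by (intro integral_norm_sum_orthogonal) auto
  finally show ?thesis .
qed

lemma sum_real_lessThan_le: "(\<Sum>l<m. real l) \<le> (real m)\<^sup>2 / 2"
proof (induction m)
  case (Suc m)
  then show ?case by (simp add: power2_eq_square field_simps)
qed simp

lemma sum_real_square_lessThan_le: "(\<Sum>l<m. (real l)\<^sup>2) \<le> (real m) ^ 3 / 2"
proof -
  have "(\<Sum>l<m. (real l)\<^sup>2) \<le> (\<Sum>l<m. real m * real l)"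
    by (intro sum_mono) (simp add: power2_eq_square mult_right_mono)
  also have "\<dots> = real m * (\<Sum>l<m. real l)" by (simp add: sum_distrib_left)
  also have "\<dots> \<le> real m * ((real m)\<^sup>2 / 2)"
    by (intro mult_left_mono sum_real_lessThan_le) simp
  finally show ?thesis by (simp add: power3_eq_cube power2_eq_square)
qed

text \<open>The drift bounds itself: variances and gradients at local iterates are controlled by the values
  at y plus the drift accumulated so far.  The coefficients come from \<open>\<Sum>l<Q. l \<le> Q\<^sup>2 / 2\<close> and
  \<open>\<Sum>l<Q. l\<^sup>2 \<le> Q\<^sup>3 / 2\<close>.\<close>

lemma drift_le:
  assumes i: "i \<in> {1..n}"
  shows "drift i \<le> \<alpha>\<^sup>2 * (real Q)\<^sup>2 * (2 * C * gap i + D) + 4 * \<alpha>\<^sup>2 * real Q ^ 3 * L * gap i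
      + (2 * \<alpha>\<^sup>2 * real Q * C * L + 2 * \<alpha>\<^sup>2 * (real Q)\<^sup>2 * L\<^sup>2) * drift i"
proof -
  let ?A = "drift i"
  define v where "v = 2 * C * gap i + D"
  define w where "w = 4 * L * gap i"
  have v0: "v \<ge> 0" and w0: "w \<ge> 0"
    unfolding v_def w_def using gap_nonneg[OF i] C D L_nonneg by auto
  have part: "(\<Sum>j<l. dev i j) \<le> ?A" if "l < Q" for l
    unfolding drift_def using that by (intro sum_mono2) (auto simp: dev_nonneg)
  have each: "dev i l \<le> 2 * \<alpha>\<^sup>2 * C * L * ?A + (2 * \<alpha>\<^sup>2 * v + 4 * \<alpha>\<^sup>2 * L\<^sup>2 * ?A) * real l
      + 2 * \<alpha>\<^sup>2 * w * (real l)\<^sup>2" if l: "l < Q" for l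
  proof -
    have "(\<Sum>j<l. \<integral>\<omega>. (norm (noise i j \<omega>))\<^sup>2 \<partial>M) \<le> (\<Sum>j<l. v + C * L * dev i j)"
      unfolding v_def using l by (intro sum_mono noise_variance_le[OF i]) auto
    also have "\<dots> = real l * v + C * L * (\<Sum>j<l. dev i j)"
      by (simp add: sum.distrib sum_distrib_left)
    also have "\<dots> \<le> real l * v + C * L * ?A"
      using part[OF l] C L_nonneg by (intro add_left_mono mult_left_mono) auto
    finally have 1: "2 * \<alpha>\<^sup>2 * (\<Sum>j<l. \<integral>\<omega>. (norm (noise i j \<omega>))\<^sup>2 \<partial>M)
        \<le> 2 * \<alpha>\<^sup>2 * (real l * v + C * L * ?A)"
      by (intro mult_left_mono) auto
    have "(\<Sum>j<l. \<integral>\<omega>. (norm (grad (f i) (x i j \<omega>)))\<^sup>2 \<partial>M) \<le> (\<Sum>j<l. w + 2 * L\<^sup>2 * dev i j)"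
      unfolding w_def using l by (intro sum_mono local_grad_sq_le[OF i]) auto
    also have "\<dots> = real l * w + 2 * L\<^sup>2 * (\<Sum>j<l. dev i j)"
      by (simp add: sum.distrib sum_distrib_left)
    also have "\<dots> \<le> real l * w + 2 * L\<^sup>2 * ?A"
      using part[OF l] by (intro add_left_mono mult_left_mono) auto
    finally have "2 * \<alpha>\<^sup>2 * real l * (\<Sum>j<l. \<integral>\<omega>. (norm (grad (f i) (x i j \<omega>)))\<^sup>2 \<partial>M)
        \<le> 2 * \<alpha>\<^sup>2 * real l * (real l * w + 2 * L\<^sup>2 * ?A)"
      by (intro mult_left_mono) auto
    with 1 dev_le[OF i, of l] l show ?thesis
      by (simp add: algebra_simps power2_eq_square)
  qed
  have "?A \<le> (\<Sum>l<Q. 2 * \<alpha>\<^sup>2 * C * L * ?A + (2 * \<alpha>\<^sup>2 * v + 4 * \<alpha>\<^sup>2 * L\<^sup>2 * ?A) * real l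
      + 2 * \<alpha>\<^sup>2 * w * (real l)\<^sup>2)"
    unfolding drift_def using each[unfolded drift_def] by (intro sum_mono) auto
  also have "\<dots> = real Q * (2 * \<alpha>\<^sup>2 * C * L * ?A) + (2 * \<alpha>\<^sup>2 * v + 4 * \<alpha>\<^sup>2 * L\<^sup>2 * ?A) * (\<Sum>l<Q. real l)
      + 2 * \<alpha>\<^sup>2 * w * (\<Sum>l<Q. (real l)\<^sup>2)"
    by (simp add: sum.distrib sum_distrib_left)
  also have "\<dots> \<le> real Q * (2 * \<alpha>\<^sup>2 * C * L * ?A)
      + (2 * \<alpha>\<^sup>2 * v + 4 * \<alpha>\<^sup>2 * L\<^sup>2 * ?A) * ((real Q)\<^sup>2 / 2) + 2 * \<alpha>\<^sup>2 * w * (real Q ^ 3 / 2)"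
    using v0 w0 drift_nonneg[of i] C L_nonneg
    by (intro add_mono mult_left_mono sum_real_lessThan_le sum_real_square_lessThan_le) auto
  finally show ?thesis by (simp add: v_def w_def algebra_simps power2_eq_square)
qed

lemma drift_one_local_step:
  assumes i: "i \<in> {1..n}" and "Q = 1"
  shows "drift i = 0"
  unfolding drift_def dev_def using assms start[OF i] by simp

text \<open>The weight \<open>1 + 2 \<alpha> C / n\<close> is the one with which the drift enters the descent inequality: 1 from
  the bias of the averaged gradient, the rest from the growth of the variance with the drift.
  A single local step has no drift, so the smallness condition is needed from two steps on.\<close>

lemma drift_le_resolved:
  assumes i: "i \<in> {1..n}"
    and small: "Q \<ge> 2 \<Longrightarrow>
      1 + 2 * (\<alpha> * C / real n) \<le> 4 * (1 - (2 * \<alpha>\<^sup>2 * real Q * C * L + 2 * \<alpha>\<^sup>2 * (real Q)\<^sup>2 * L\<^sup>2))"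
  shows "(1 + 2 * (\<alpha> * C / real n)) * drift i
      \<le> 4 * (\<alpha>\<^sup>2 * (real Q)\<^sup>2 * (2 * C * gap i + D) + 4 * \<alpha>\<^sup>2 * real Q ^ 3 * L * gap i)"
proof (cases "Q = 1")
  case True
  then show ?thesis
    using drift_one_local_step[OF i] gap_nonneg[OF i] C D L_nonneg by simp
next
  case False
  then have "Q \<ge> 2" using Q by simp
  from mult_right_mono[OF small[OF this] drift_nonneg[of i]] drift_le[OF i]
  show ?thesis by (simp add: algebra_simps)
qed

section \<open>Descent over one round\<close>

abbreviation agent_steps :: "(nat \<times> nat) set" where
  "agent_steps \<equiv> {1..n} \<times> {..<Q}"

definition avg_noise :: "'a \<Rightarrow> real^'p" where
  "avg_noise \<omega> = (1 / real n) *\<^sub>R (\<Sum>p\<in>agent_steps. noise (fst p) (snd p) \<omega>)"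

definition avg_grad :: "'a \<Rightarrow> real^'p" where
  "avg_grad \<omega> = (1 / real n) *\<^sub>R (\<Sum>p\<in>agent_steps. grad (f (fst p)) (x (fst p) (snd p) \<omega>))"

definition next_iterate :: "'a \<Rightarrow> real^'p" where
  "next_iterate \<omega> = (1 / real n) *\<^sub>R (\<Sum>i=1..n. x i Q \<omega>)"

lemma next_iterate_eq: "next_iterate \<omega> = y \<omega> - \<alpha> *\<^sub>R (avg_grad \<omega> + avg_noise \<omega>)"
proof -
  have "x i Q \<omega> = y \<omega> - \<alpha> *\<^sub>R (\<Sum>l<Q. G i l \<omega>)" if "i \<in> {1..n}" for i
    using x_minus_start[OF that, of Q \<omega>] by (simp add: algebra_simps)
  then have "next_iterate \<omega> = (1 / real n) *\<^sub>R (\<Sum>i=1..n. y \<omega> - \<alpha> *\<^sub>R (\<Sum>l<Q. G i l \<omega>))"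
    unfolding next_iterate_def by simp
  also have "\<dots> = y \<omega> - \<alpha> *\<^sub>R ((1 / real n) *\<^sub>R (\<Sum>i=1..n. \<Sum>l<Q. G i l \<omega>))"
    using n by (simp add: sum_subtractf scaleR_diff_right scaleR_sum_right sum_constant_scaleR
        del: sum_constant)
  also have "(\<Sum>i=1..n. \<Sum>l<Q. G i l \<omega>)
      = (\<Sum>p\<in>agent_steps. grad (f (fst p)) (x (fst p) (snd p) \<omega>) + noise (fst p) (snd p) \<omega>)"
    by (simp add: sum.cartesian_product case_prod_beta G_eq add.commute)
  finally show ?thesis
    unfolding avg_grad_def avg_noise_def by (simp add: sum.distrib scaleR_add_right)
qed

lemma next_iterate_sq_integrable: "sq_integrable M next_iterate"
  unfolding next_iterate_def[abs_def]
  by (intro sq_integrable_scaleR sq_integrable_sum x_sq_integrable) auto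

lemma avg_noise_sq_integrable: "sq_integrable M avg_noise"
  unfolding avg_noise_def[abs_def]
  by (intro sq_integrable_scaleR sq_integrable_sum noise_sq) auto

lemma smooth_avg: "L_smooth L (avg_obj n f)"
  by (rule L_smooth_avg_obj[OF smooth n])

lemma bdd_avg: "bdd_below (range (avg_obj n f))"
  by (rule bdd_below_avg_obj[OF bdd])

text \<open>By orthogonality the variances add up, which is the source of the factor \<open>1 / n\<close> in the rate.\<close>

lemma avg_noise_variance:
  "(\<integral>\<omega>. (norm (avg_noise \<omega>))\<^sup>2 \<partial>M)
    = (1 / real n)\<^sup>2 * (\<Sum>p\<in>agent_steps. \<integral>\<omega>. (norm (noise (fst p) (snd p) \<omega>))\<^sup>2 \<partial>M)"
proof -
  have "(\<integral>\<omega>. (norm (\<Sum>p\<in>agent_steps. noise (fst p) (snd p) \<omega>))\<^sup>2 \<partial>M)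
      = (\<Sum>p\<in>agent_steps. \<integral>\<omega>. (norm (noise (fst p) (snd p) \<omega>))\<^sup>2 \<partial>M)"
    by (rule integral_norm_sum_orthogonal) (auto intro: noise_orthogonal)
  then show ?thesis
    unfolding avg_noise_def by (simp add: power_divide)
qed

lemma avg_noise_centred: "(\<integral>\<omega>. inner (grad (avg_obj n f) (y \<omega>)) (avg_noise \<omega>) \<partial>M) = 0"
proof -
  let ?Z = "\<lambda>\<omega>. grad (avg_obj n f) (y \<omega>)"
  have Z: "sq_integrable M ?Z" by (rule sq_integrable_grad[OF smooth_avg start_sq])
  have "0 < Q" and 1: "1 \<in> {1..n}" using Q n by auto
  then have y: "y \<in> borel_measurable (F 0)" using adapted[OF 1] start[OF 1] by metis
  have ZF: "?Z \<in> borel_measurable (F l)" if "l < Q" for l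
    using y L_smooth_continuous_grad[OF smooth_avg]
    by (intro borel_measurable_continuous_on[of "grad (avg_obj n f)"]
        measurable_from_subalg[OF filtration_mono[OF _ that]]) auto
  have "(\<integral>\<omega>. inner (?Z \<omega>) (avg_noise \<omega>) \<partial>M)
      = (\<integral>\<omega>. (\<Sum>p\<in>agent_steps. (1 / real n) * inner (?Z \<omega>) (noise (fst p) (snd p) \<omega>)) \<partial>M)"
    unfolding avg_noise_def by (simp add: inner_sum_right sum_divide_distrib)
  also have "\<dots> = (\<Sum>p\<in>agent_steps. (1 / real n) * (\<integral>\<omega>. inner (?Z \<omega>) (noise (fst p) (snd p) \<omega>) \<partial>M))"
    using Z by (subst Bochner_Integration.integral_sum)
      (auto intro!: integrable_mult_right integrable_inner noise_sq)
  also have "\<dots> = 0"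
    using Z ZF by (intro sum.neutral ballI) (auto intro!: noise_orthogonal_past)
  finally show ?thesis .
qed

lemma client_drift_error:
  "(norm (real Q *\<^sub>R grad (avg_obj n f) (y \<omega>) - avg_grad \<omega>))\<^sup>2
    \<le> real Q / real n * L\<^sup>2 * (\<Sum>p\<in>agent_steps. (norm (x (fst p) (snd p) \<omega> - y \<omega>))\<^sup>2)"
proof -
  let ?d = "\<lambda>p. grad (f (fst p)) (y \<omega>) - grad (f (fst p)) (x (fst p) (snd p) \<omega>)"
  have "(\<Sum>p\<in>agent_steps. grad (f (fst p)) (y \<omega>)) = (\<Sum>i=1..n. \<Sum>l<Q. grad (f i) (y \<omega>))"
    by (simp add: sum.cartesian_product case_prod_beta del: sum_constant)
  also have "\<dots> = real Q *\<^sub>R (\<Sum>i=1..n. grad (f i) (y \<omega>))"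
    by (simp add: scaleR_sum_right sum_constant_scaleR del: sum_constant)
  finally have "real Q *\<^sub>R grad (avg_obj n f) (y \<omega>)
      = (1 / real n) *\<^sub>R (\<Sum>p\<in>agent_steps. grad (f (fst p)) (y \<omega>))"
    unfolding grad_avg_obj[OF smooth] by (simp only: scaleR_left_commute)
  then have "(norm (real Q *\<^sub>R grad (avg_obj n f) (y \<omega>) - avg_grad \<omega>))\<^sup>2
      = (1 / real n)\<^sup>2 * (norm (\<Sum>p\<in>agent_steps. ?d p))\<^sup>2"
    unfolding avg_grad_def
    by (simp add: sum_subtractf power_divide flip: scaleR_diff_right)
  also have "\<dots> \<le> (1 / real n)\<^sup>2 * (real (card agent_steps) * (\<Sum>p\<in>agent_steps. (norm (?d p))\<^sup>2))"
    by (intro mult_left_mono norm_sum_sq_le) simp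
  also have "\<dots> \<le> (1 / real n)\<^sup>2 * (real (card agent_steps)
      * (\<Sum>p\<in>agent_steps. L\<^sup>2 * (norm (x (fst p) (snd p) \<omega> - y \<omega>))\<^sup>2))"
  proof (intro mult_left_mono sum_mono)
    fix p assume "p \<in> agent_steps"
    then have "L_smooth L (f (fst p))" using smooth by auto
    then have "norm (?d p) \<le> L * norm (x (fst p) (snd p) \<omega> - y \<omega>)"
      using L_smooth_lipschitz norm_minus_commute by metis
    then have "(norm (?d p))\<^sup>2 \<le> (L * norm (x (fst p) (snd p) \<omega> - y \<omega>))\<^sup>2"
      by (intro power_mono) auto
    then show "(norm (?d p))\<^sup>2 \<le> L\<^sup>2 * (norm (x (fst p) (snd p) \<omega> - y \<omega>))\<^sup>2"
      by (simp add: power_mult_distrib)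
  qed auto
  also have "\<dots> = real Q / real n * L\<^sup>2 * (\<Sum>p\<in>agent_steps. (norm (x (fst p) (snd p) \<omega> - y \<omega>))\<^sup>2)"
    using n by (simp add: power2_eq_square sum_distrib_left[symmetric])
  finally show ?thesis .
qed

text \<open>The averaged noise is not orthogonal to the averaged gradient, since gradients at later local
  steps depend on earlier noise.  Therefore \<open>|h + e|\<^sup>2\<close> is split at the price of a factor 2, and the
  part \<open>|h|\<^sup>2\<close> is absorbed by the square of the averaged gradient h that polarization of
  \<open>\<langle>\<nabla>f(y), h\<rangle>\<close> provides.\<close>

lemma descent_pointwise:
  assumes small: "2 * \<alpha> * L * real Q \<le> 1"
  shows "avg_obj n f (next_iterate \<omega>) \<le> avg_obj n f (y \<omega>)
      - \<alpha> * real Q / 2 * (norm (grad (avg_obj n f) (y \<omega>)))\<^sup>2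
      + \<alpha> * L\<^sup>2 / (2 * real n) * (\<Sum>p\<in>agent_steps. (norm (x (fst p) (snd p) \<omega> - y \<omega>))\<^sup>2)
      - \<alpha> * inner (grad (avg_obj n f) (y \<omega>)) (avg_noise \<omega>)
      + L * \<alpha>\<^sup>2 * (norm (avg_noise \<omega>))\<^sup>2"
proof -
  let ?g = "grad (avg_obj n f) (y \<omega>)" and ?h = "avg_grad \<omega>" and ?e = "avg_noise \<omega>"
  let ?S = "\<Sum>p\<in>agent_steps. (norm (x (fst p) (snd p) \<omega> - y \<omega>))\<^sup>2"
  have Q0: "real Q > 0" using Q by simp
  have polar: "inner ?g ?h = (real Q * (norm ?g)\<^sup>2 + (norm ?h)\<^sup>2 / real Q
      - (norm (real Q *\<^sub>R ?g - ?h))\<^sup>2 / real Q) / 2"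
    using Q0 unfolding power2_norm_eq_inner
    by (simp add: inner_diff_left inner_diff_right inner_commute field_simps)
  have "avg_obj n f (next_iterate \<omega>) \<le> avg_obj n f (y \<omega>) + inner ?g (- (\<alpha> *\<^sub>R (?h + ?e)))
      + L / 2 * (norm (- (\<alpha> *\<^sub>R (?h + ?e))))\<^sup>2"
    using L_smooth_upper[OF smooth_avg, of "next_iterate \<omega>" "y \<omega>"] by (simp add: next_iterate_eq)
  also have "\<dots> = avg_obj n f (y \<omega>) - \<alpha> * inner ?g ?h - \<alpha> * inner ?g ?e
      + L * \<alpha>\<^sup>2 / 2 * (norm (?h + ?e))\<^sup>2"
  proof -
    have "(norm (- (\<alpha> *\<^sub>R (?h + ?e))))\<^sup>2 = \<alpha>\<^sup>2 * (norm (?h + ?e))\<^sup>2"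
      by (simp only: norm_minus_cancel norm_scaleR power_mult_distrib power2_abs)
    then show ?thesis by (simp add: inner_add_right inner_diff_right algebra_simps)
  qed
  also have "\<dots> \<le> avg_obj n f (y \<omega>) - \<alpha> * inner ?g ?h - \<alpha> * inner ?g ?e
      + L * \<alpha>\<^sup>2 / 2 * (2 * (norm ?h)\<^sup>2 + 2 * (norm ?e)\<^sup>2)"
    using L_nonneg by (intro add_left_mono mult_left_mono norm_add_sq_le) auto
  also have "\<dots> = avg_obj n f (y \<omega>) - \<alpha> * inner ?g ?h - \<alpha> * inner ?g ?e
      + L * \<alpha>\<^sup>2 * (norm ?h)\<^sup>2 + L * \<alpha>\<^sup>2 * (norm ?e)\<^sup>2"
    by (simp add: algebra_simps)
  also have "L * \<alpha>\<^sup>2 * (norm ?h)\<^sup>2 \<le> \<alpha> / (2 * real Q) * (norm ?h)\<^sup>2"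
  proof (rule mult_right_mono)
    have "\<alpha> * (2 * \<alpha> * L * real Q) \<le> \<alpha> * 1" using small \<alpha> by (intro mult_left_mono) auto
    then show "L * \<alpha>\<^sup>2 \<le> \<alpha> / (2 * real Q)" using Q0 by (simp add: field_simps power2_eq_square)
  qed simp
  finally have "avg_obj n f (next_iterate \<omega>) \<le> avg_obj n f (y \<omega>) - \<alpha> * inner ?g ?h - \<alpha> * inner ?g ?e
      + \<alpha> / (2 * real Q) * (norm ?h)\<^sup>2 + L * \<alpha>\<^sup>2 * (norm ?e)\<^sup>2" by simp
  also have "\<dots> = avg_obj n f (y \<omega>) - \<alpha> * real Q / 2 * (norm ?g)\<^sup>2
      + \<alpha> / (2 * real Q) * (norm (real Q *\<^sub>R ?g - ?h))\<^sup>2 - \<alpha> * inner ?g ?e + L * \<alpha>\<^sup>2 * (norm ?e)\<^sup>2"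
    unfolding polar using Q0 by (simp add: field_simps)
  also have "\<alpha> / (2 * real Q) * (norm (real Q *\<^sub>R ?g - ?h))\<^sup>2
      \<le> \<alpha> / (2 * real Q) * (real Q / real n * L\<^sup>2 * ?S)"
    using \<alpha> by (intro mult_left_mono client_drift_error) auto
  also have "\<alpha> / (2 * real Q) * (real Q / real n * L\<^sup>2 * ?S) = \<alpha> * L\<^sup>2 / (2 * real n) * ?S"
    using Q0 by (simp add: field_simps)
  finally show ?thesis by simp
qed

lemma descent_expectation:
  assumes small: "2 * \<alpha> * L * real Q \<le> 1"
  shows "(\<integral>\<omega>. avg_obj n f (next_iterate \<omega>) \<partial>M) \<le> (\<integral>\<omega>. avg_obj n f (y \<omega>) \<partial>M)
      - \<alpha> * real Q / 2 * (\<integral>\<omega>. (norm (grad (avg_obj n f) (y \<omega>)))\<^sup>2 \<partial>M)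
      + \<alpha> * L\<^sup>2 / (2 * real n) * (\<Sum>i=1..n. drift i)
      + L * \<alpha>\<^sup>2 * (\<integral>\<omega>. (norm (avg_noise \<omega>))\<^sup>2 \<partial>M)"
proof -
  let ?S = "\<lambda>\<omega>. \<Sum>p\<in>agent_steps. (norm (x (fst p) (snd p) \<omega> - y \<omega>))\<^sup>2"
  have Z: "sq_integrable M (\<lambda>\<omega>. grad (avg_obj n f) (y \<omega>))"
    by (rule sq_integrable_grad[OF smooth_avg start_sq])
  note ints = integrable_smooth_comp[OF smooth_avg bdd_avg start_sq] sq_integrableD(2)[OF Z]
    integrable_inner[OF Z avg_noise_sq_integrable] sq_integrableD(2)[OF avg_noise_sq_integrable]
  have intS: "integrable M ?S"
    by (intro Bochner_Integration.integrable_sum x_dev_integrable) auto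
  have "(\<integral>\<omega>. ?S \<omega> \<partial>M) = (\<Sum>p\<in>agent_steps. dev (fst p) (snd p))"
    unfolding dev_def by (intro Bochner_Integration.integral_sum x_dev_integrable) auto
  also have "\<dots> = (\<Sum>i=1..n. drift i)"
    unfolding drift_def by (simp add: sum.cartesian_product case_prod_beta)
  finally have S: "(\<integral>\<omega>. ?S \<omega> \<partial>M) = (\<Sum>i=1..n. drift i)" .
  have "(\<integral>\<omega>. avg_obj n f (next_iterate \<omega>) \<partial>M) \<le> (\<integral>\<omega>. avg_obj n f (y \<omega>)
      - \<alpha> * real Q / 2 * (norm (grad (avg_obj n f) (y \<omega>)))\<^sup>2
      + \<alpha> * L\<^sup>2 / (2 * real n) * ?S \<omega>
      - \<alpha> * inner (grad (avg_obj n f) (y \<omega>)) (avg_noise \<omega>)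
      + L * \<alpha>\<^sup>2 * (norm (avg_noise \<omega>))\<^sup>2 \<partial>M)"
    by (intro integral_mono descent_pointwise[OF small] integrable_smooth_comp[OF smooth_avg bdd_avg]
        next_iterate_sq_integrable Bochner_Integration.integrable_add
        Bochner_Integration.integrable_diff integrable_mult_right ints intS)
  also have "\<dots> = (\<integral>\<omega>. avg_obj n f (y \<omega>) \<partial>M)
      - \<alpha> * real Q / 2 * (\<integral>\<omega>. (norm (grad (avg_obj n f) (y \<omega>)))\<^sup>2 \<partial>M)
      + \<alpha> * L\<^sup>2 / (2 * real n) * (\<integral>\<omega>. ?S \<omega> \<partial>M)
      - \<alpha> * (\<integral>\<omega>. inner (grad (avg_obj n f) (y \<omega>)) (avg_noise \<omega>) \<partial>M)
      + L * \<alpha>\<^sup>2 * (\<integral>\<omega>. (norm (avg_noise \<omega>))\<^sup>2 \<partial>M)"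
    by (simp only: Bochner_Integration.integral_add Bochner_Integration.integral_diff integral_mult_right_zero
        Bochner_Integration.integrable_add Bochner_Integration.integrable_diff integrable_mult_right ints intS)
  finally show ?thesis unfolding S avg_noise_centred by simp
qed

lemma avg_gap:
  "(\<Sum>i=1..n. gap i) / real n
    = (\<integral>\<omega>. avg_obj n f (y \<omega>) - inf_val (avg_obj n f) \<partial>M) + sigma_star n f"
proof -
  have "(\<Sum>i=1..n. gap i) = (\<integral>\<omega>. (\<Sum>i=1..n. f i (y \<omega>) - inf_val (f i)) \<partial>M)"
    unfolding gap_def
    by (intro Bochner_Integration.integral_sum[symmetric] Bochner_Integration.integrable_diff
        value_integrable start_sq) auto
  then have "(\<Sum>i=1..n. gap i) / real n
      = (\<integral>\<omega>. (\<Sum>i=1..n. f i (y \<omega>) - inf_val (f i)) / real n \<partial>M)" by simp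
  also have "\<dots> = (\<integral>\<omega>. (avg_obj n f (y \<omega>) - inf_val (avg_obj n f)) + sigma_star n f \<partial>M)"
    unfolding avg_gap_eq ..
  also have "\<dots> = (\<integral>\<omega>. avg_obj n f (y \<omega>) - inf_val (avg_obj n f) \<partial>M) + sigma_star n f"
    using integrable_smooth_comp[OF smooth_avg bdd_avg start_sq] by (simp add: prob_space)
  finally show ?thesis .
qed

text \<open>The quantity \<open>\<Psi>\<close> is the average of the expected gaps of the agents at y, to which both the
  variances and the drift are compared.\<close>

lemma round_recursion:
  fixes \<Delta> \<Delta>' r \<Psi> :: real
  assumes small: "2 * \<alpha> * L * real Q \<le> 1"
    and small': "Q \<ge> 2 \<Longrightarrow>
      1 + 2 * (\<alpha> * C / real n) \<le> 4 * (1 - (2 * \<alpha>\<^sup>2 * real Q * C * L + 2 * \<alpha>\<^sup>2 * (real Q)\<^sup>2 * L\<^sup>2))"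
  defines "\<Delta> \<equiv> (\<integral>\<omega>. avg_obj n f (y \<omega>) - inf_val (avg_obj n f) \<partial>M)"
    and "\<Delta>' \<equiv> (\<integral>\<omega>. avg_obj n f (next_iterate \<omega>) - inf_val (avg_obj n f) \<partial>M)"
    and "r \<equiv> (\<integral>\<omega>. (norm (grad (avg_obj n f) (y \<omega>)))\<^sup>2 \<partial>M)"
    and "\<Psi> \<equiv> \<Delta> + sigma_star n f"
  shows "\<Delta>' \<le> \<Delta> - \<alpha> * real Q / 2 * r
      + 2 * \<alpha> * L\<^sup>2 * (\<alpha>\<^sup>2 * (real Q)\<^sup>2 * (2 * C * \<Psi> + D) + 4 * \<alpha>\<^sup>2 * real Q ^ 3 * L * \<Psi>)
      + L * \<alpha>\<^sup>2 * real Q / real n * (2 * C * \<Psi> + D)"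
proof -
  have n0: "real n > 0" using n by simp
  define S where "S = (\<Sum>i=1..n. drift i)"
  have S0: "S \<ge> 0" unfolding S_def by (simp add: sum_nonneg drift_nonneg)
  have gaps: "(\<Sum>i=1..n. gap i) = real n * \<Psi>"
    using avg_gap n0 unfolding \<Psi>_def \<Delta>_def by (simp add: field_simps)
  have "(\<Sum>p\<in>agent_steps. \<integral>\<omega>. (norm (noise (fst p) (snd p) \<omega>))\<^sup>2 \<partial>M)
      \<le> (\<Sum>p\<in>agent_steps. 2 * C * gap (fst p) + D + C * L * dev (fst p) (snd p))"
    by (intro sum_mono noise_variance_le) auto
  also have "\<dots> = (\<Sum>i=1..n. \<Sum>l<Q. 2 * C * gap i + D + C * L * dev i l)"
    by (simp add: sum.cartesian_product case_prod_beta)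
  also have "\<dots> = real Q * (2 * C * (\<Sum>i=1..n. gap i) + real n * D) + C * L * S"
    unfolding S_def drift_def by (simp add: sum.distrib sum_distrib_left algebra_simps)
  finally have "(\<integral>\<omega>. (norm (avg_noise \<omega>))\<^sup>2 \<partial>M)
      \<le> (1 / real n)\<^sup>2 * (real Q * (2 * C * (\<Sum>i=1..n. gap i) + real n * D) + C * L * S)"
    unfolding avg_noise_variance by (intro mult_left_mono) auto
  also have "\<dots> = real Q / real n * (2 * C * \<Psi> + D) + C * L / (real n)\<^sup>2 * S"
    unfolding gaps using n0 by (simp add: field_simps power2_eq_square)
  finally have "L * \<alpha>\<^sup>2 * (\<integral>\<omega>. (norm (avg_noise \<omega>))\<^sup>2 \<partial>M)
      \<le> L * \<alpha>\<^sup>2 * (real Q / real n * (2 * C * \<Psi> + D) + C * L / (real n)\<^sup>2 * S)"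
    using L_nonneg by (intro mult_left_mono) auto
  then have noise_part: "\<alpha> * L\<^sup>2 / (2 * real n) * S + L * \<alpha>\<^sup>2 * (\<integral>\<omega>. (norm (avg_noise \<omega>))\<^sup>2 \<partial>M)
      \<le> \<alpha> * L\<^sup>2 / (2 * real n) * ((1 + 2 * (\<alpha> * C / real n)) * S) + L * \<alpha>\<^sup>2 * real Q / real n * (2 * C * \<Psi> + D)"
  proof -
    have "L * \<alpha>\<^sup>2 * (real Q / real n * w + C * L / (real n)\<^sup>2 * S)
        = \<alpha> * L\<^sup>2 / (2 * real n) * (2 * (\<alpha> * C / real n) * S) + L * \<alpha>\<^sup>2 * real Q / real n * w" for w
      using n0 by (simp add: field_simps power2_eq_square)
    moreover have "\<alpha> * L\<^sup>2 / (2 * real n) * ((1 + 2 * (\<alpha> * C / real n)) * S)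
        = \<alpha> * L\<^sup>2 / (2 * real n) * S + \<alpha> * L\<^sup>2 / (2 * real n) * (2 * (\<alpha> * C / real n) * S)"
      by (simp only: distrib_right distrib_left mult_1)
    moreover note \<open>L * \<alpha>\<^sup>2 * (\<integral>\<omega>. (norm (avg_noise \<omega>))\<^sup>2 \<partial>M) \<le> _\<close>
    ultimately show ?thesis by simp
  qed
  have "(1 + 2 * (\<alpha> * C / real n)) * S
      \<le> (\<Sum>i=1..n. 4 * (\<alpha>\<^sup>2 * (real Q)\<^sup>2 * (2 * C * gap i + D) + 4 * \<alpha>\<^sup>2 * real Q ^ 3 * L * gap i))"
    unfolding S_def sum_distrib_left using small' by (intro sum_mono drift_le_resolved) auto
  also have "\<dots> = 4 * (\<alpha>\<^sup>2 * (real Q)\<^sup>2 * (2 * C * (\<Sum>i=1..n. gap i) + real n * D)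
      + 4 * \<alpha>\<^sup>2 * real Q ^ 3 * L * (\<Sum>i=1..n. gap i))"
    by (simp add: sum.distrib sum_distrib_left algebra_simps)
  also have "\<dots> = 4 * real n * (\<alpha>\<^sup>2 * (real Q)\<^sup>2 * (2 * C * \<Psi> + D) + 4 * \<alpha>\<^sup>2 * real Q ^ 3 * L * \<Psi>)"
    unfolding gaps by (simp add: algebra_simps)
  finally have "\<alpha> * L\<^sup>2 / (2 * real n) * ((1 + 2 * (\<alpha> * C / real n)) * S) \<le> \<alpha> * L\<^sup>2 / (2 * real n)
      * (4 * real n * (\<alpha>\<^sup>2 * (real Q)\<^sup>2 * (2 * C * \<Psi> + D) + 4 * \<alpha>\<^sup>2 * real Q ^ 3 * L * \<Psi>))"
    using \<alpha> by (intro mult_left_mono) auto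
  also have "\<dots> = 2 * \<alpha> * L\<^sup>2 * (\<alpha>\<^sup>2 * (real Q)\<^sup>2 * (2 * C * \<Psi> + D) + 4 * \<alpha>\<^sup>2 * real Q ^ 3 * L * \<Psi>)"
    using n0 by (simp add: field_simps)
  finally have drift_part: "\<alpha> * L\<^sup>2 / (2 * real n) * ((1 + 2 * (\<alpha> * C / real n)) * S)
      \<le> 2 * \<alpha> * L\<^sup>2 * (\<alpha>\<^sup>2 * (real Q)\<^sup>2 * (2 * C * \<Psi> + D) + 4 * \<alpha>\<^sup>2 * real Q ^ 3 * L * \<Psi>)" .
  have "\<Delta>' - \<Delta> = (\<integral>\<omega>. avg_obj n f (next_iterate \<omega>) \<partial>M) - (\<integral>\<omega>. avg_obj n f (y \<omega>) \<partial>M)"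
    unfolding \<Delta>_def \<Delta>'_def
    using integrable_smooth_comp[OF smooth_avg bdd_avg start_sq]
      integrable_smooth_comp[OF smooth_avg bdd_avg next_iterate_sq_integrable]
    by (simp add: prob_space)
  then show ?thesis
    using descent_expectation[OF small] noise_part drift_part unfolding r_def S_def by linarith
qed

end

section \<open>The stepsize condition\<close>

lemma le_Min_four_iff: "m \<le> Min {u, v, w, z} \<longleftrightarrow> m \<le> u \<and> m \<le> v \<and> m \<le> w \<and> m \<le> z"
  for m :: "'b::linorder"
  by simp

lemma le_stepsize_boundD:
  assumes "n \<ge> 1" and "Q \<ge> 1" and "T \<ge> 1" and C: "C \<ge> 0" and L: "L \<ge> 0" and a: "\<alpha> > 0"
    and le: "ereal \<alpha> \<le> stepsize_bound n Q T C L"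
  shows "\<alpha>\<^sup>2 * (real Q * (C\<^sup>2 + L\<^sup>2) * real T) \<le> real n"
    and "14 * \<alpha> ^ 3 * real Q ^ 3 * L\<^sup>2 * (2 * C + 3 * L) * real T \<le> 1"
    and "\<alpha> * C \<le> 1"
    and "8 * \<alpha>\<^sup>2 * real Q * C * L \<le> 1"
proof -
  have bounds: "ereal \<alpha> \<le> top_if_zero (real Q * (C\<^sup>2 + L\<^sup>2) * real T)
            (sqrt (real n / (real Q * (C\<^sup>2 + L\<^sup>2) * real T)))"
      "ereal \<alpha> \<le> top_if_zero (14 * real Q ^ 3 * L\<^sup>2 * (2 * C + 3 * L) * real T)
            (root 3 (1 / (14 * real Q ^ 3 * L\<^sup>2 * (2 * C + 3 * L) * real T)))"
      "ereal \<alpha> \<le> top_if_zero C (1 / C)"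
      "ereal \<alpha> \<le> top_if_zero (2 * sqrt (2 * real Q * C * L)) (1 / (2 * sqrt (2 * real Q * C * L)))"
    using le[unfolded stepsize_bound_def le_Min_four_iff] by blast+
  show "\<alpha>\<^sup>2 * (real Q * (C\<^sup>2 + L\<^sup>2) * real T) \<le> real n"
  proof (cases "real Q * (C\<^sup>2 + L\<^sup>2) * real T = 0")
    case True
    show ?thesis unfolding True by simp
  next
    case False
    define z where "z = real Q * (C\<^sup>2 + L\<^sup>2) * real T"
    have "z \<ge> 0" unfolding z_def by simp
    with False[folded z_def] have z: "z > 0" by linarith
    have "\<alpha> \<le> sqrt (real n / z)" using bounds(1)[folded z_def] z by (simp add: top_if_zero_def)
    then have "\<alpha>\<^sup>2 \<le> (sqrt (real n / z))\<^sup>2" using a by (intro power_mono) auto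
    also have "\<dots> = real n / z" using z by simp
    finally show ?thesis using z unfolding z_def[symmetric] by (simp add: field_simps)
  qed
  show "14 * \<alpha> ^ 3 * real Q ^ 3 * L\<^sup>2 * (2 * C + 3 * L) * real T \<le> 1"
  proof -
    define z where "z = 14 * real Q ^ 3 * L\<^sup>2 * (2 * C + 3 * L) * real T"
    have "\<alpha> ^ 3 * z \<le> 1"
    proof (cases "z = 0")
      case False
      have "z \<ge> 0" unfolding z_def using C L by simp
      with False have z: "z > 0" by linarith
      have "\<alpha> \<le> root 3 (1 / z)" using bounds(2)[folded z_def] z by (simp add: top_if_zero_def)
      then have "\<alpha> ^ 3 \<le> (root 3 (1 / z)) ^ 3" using a by (intro power_mono) auto
      also have "\<dots> = 1 / z" using z by (simp add: odd_real_root_pow)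
      finally show ?thesis using z by (simp add: field_simps)
    qed simp
    then show ?thesis unfolding z_def by (simp add: algebra_simps)
  qed
  show "\<alpha> * C \<le> 1"
    using bounds(3) C unfolding top_if_zero_def by (cases "C = 0") (auto simp: field_simps)
  show "8 * \<alpha>\<^sup>2 * real Q * C * L \<le> 1"
  proof -
    define z where "z = 2 * real Q * C * L"
    have z0: "z \<ge> 0" unfolding z_def using C L by simp
    have "\<alpha>\<^sup>2 * (4 * z) \<le> 1"
    proof (cases "z = 0")
      case False
      then have z: "z > 0" using z0 by simp
      have "\<alpha> \<le> 1 / (2 * sqrt z)" using bounds(4)[folded z_def] z by (simp add: top_if_zero_def)
      then have "\<alpha>\<^sup>2 \<le> (1 / (2 * sqrt z))\<^sup>2" using a by (intro power_mono) auto
      also have "\<dots> = 1 / (4 * z)" using z by (simp add: power_divide power_mult_distrib)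
      finally show ?thesis using z by (simp add: field_simps)
    qed simp
    then show ?thesis unfolding z_def by (simp add: algebra_simps)
  qed
qed

text \<open>In terms of \<open>c = a C\<close>, \<open>d = c / N\<close> and \<open>z = a L Q\<close> the claim is \<open>2 d + 8 c z + 8 z\<^sup>2 \<le> 3\<close>.  The three
  terms cannot be large together: for large c the bound on \<open>c z\<close> forces z to be small.\<close>

lemma stepsize_drift_condition:
  fixes a C L Q N :: real
  assumes a: "a > 0" and C: "C \<ge> 0" and L: "L \<ge> 0" and Q: "Q \<ge> 0" and N: "N \<ge> 1"
    and h1: "2 * (a * C / N)\<^sup>2 \<le> 1"
    and h2: "42 * (a * L * Q) ^ 3 \<le> 1"
    and h4: "8 * (a * C) * (a * L * Q) \<le> 1"
  shows "1 + 2 * (a * C / N) \<le> 4 * (1 - (2 * a\<^sup>2 * Q * C * L + 2 * a\<^sup>2 * Q\<^sup>2 * L\<^sup>2))"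
proof -
  define c where "c = a * C"
  define d where "d = c / N"
  define z where "z = a * L * Q"
  have c0: "c \<ge> 0" and z0: "z \<ge> 0" unfolding c_def z_def using a C L Q by auto
  have dc: "d \<le> c" using c0 N divide_left_mono[of 1 N c] unfolding d_def by simp
  (* The exact thresholds are 1 / sqrt 2 here and the cube root of 1 / 42 below. *)
  have d: "d \<le> 3 / 4"
  proof (rule ccontr)
    assume "\<not> d \<le> 3 / 4"
    then have "(3 / 4)\<^sup>2 < d\<^sup>2" by (intro power_strict_mono) auto
    then show False using h1 unfolding c_def[symmetric] d_def[symmetric] by (simp add: power2_eq_square)
  qed
  have z: "z \<le> 3 / 10"
  proof (rule ccontr)
    assume "\<not> z \<le> 3 / 10"
    then have "(3 / 10) ^ 3 < z ^ 3" by (intro power_strict_mono) auto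
    then show False using h2 unfolding z_def[symmetric] by (simp add: power3_eq_cube)
  qed
  have cz: "8 * (c * z) \<le> 1" using h4 unfolding c_def z_def by (simp only: mult.assoc)
  have "2 * d + 8 * z\<^sup>2 \<le> 2"
  proof (cases "c \<le> 3 / 5")
    case True
    have "z\<^sup>2 \<le> (3 / 10)\<^sup>2" using z z0 by (intro power_mono) auto
    then show ?thesis using True dc by (simp add: power2_eq_square)
  next
    case False
    have "3 / 5 * z \<le> c * z" using False z0 by (intro mult_right_mono) auto
    then have "z \<le> 5 / 24" using cz by simp
    then have "z\<^sup>2 \<le> (5 / 24)\<^sup>2" using z0 by (intro power_mono) auto
    then show ?thesis using d by (simp add: power2_eq_square)
  qed
  moreover have "2 * a\<^sup>2 * Q * C * L + 2 * a\<^sup>2 * Q\<^sup>2 * L\<^sup>2 = 2 * (c * z) + 2 * z\<^sup>2"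
    unfolding c_def z_def by (simp add: power2_eq_square algebra_simps)
  ultimately show ?thesis unfolding c_def[symmetric] d_def[symmetric] using cz by simp
qed

section \<open>From the recursion to the smallest gradient\<close>

text \<open>If c m exceeds N, then every round gains the surplus \<open>c m - N\<close>, up to the growth factor, and after
  T rounds the surplus must be paid from \<open>\<Delta> 0\<close>.  In this form the growth factor multiplies only the
  initial value and not the perturbation N.\<close>

lemma perturbed_recursion_bound:
  fixes \<Delta> r :: "nat \<Rightarrow> real"
  assumes rec: "\<And>t. t < T \<Longrightarrow> \<Delta> (Suc t) \<le> (1 + b) * \<Delta> t - c * r t + N"
    and nonneg: "\<And>t. t \<le> T \<Longrightarrow> \<Delta> t \<ge> 0" and b: "b \<ge> 0" and c: "c > 0" and T: "T \<ge> 1"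
    and m: "\<And>t. t < T \<Longrightarrow> m \<le> r t"
  shows "m \<le> (1 + b) ^ T * \<Delta> 0 / (c * real T) + N / c"
proof (cases "c * m \<le> N")
  case True
  then have "m \<le> N / c" using c by (simp add: field_simps)
  moreover have "0 \<le> (1 + b) ^ T * \<Delta> 0 / (c * real T)" using nonneg[of 0] b c by simp
  ultimately show ?thesis by simp
next
  case False
  have "\<Delta> t \<le> (1 + b) ^ t * \<Delta> 0 - real t * (c * m - N)" if "t \<le> T" for t
    using that
  proof (induction t)
    case (Suc t)
    have "c * m \<le> c * r t" using m[of t] Suc.prems c by simp
    then have "\<Delta> (Suc t) \<le> (1 + b) * \<Delta> t - (c * m - N)" using rec[of t] Suc.prems by simp
    also have "\<dots> \<le> (1 + b) * ((1 + b) ^ t * \<Delta> 0 - real t * (c * m - N)) - (c * m - N)"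
      using Suc b by (intro diff_right_mono mult_left_mono) auto
    also have "\<dots> \<le> (1 + b) ^ Suc t * \<Delta> 0 - real (Suc t) * (c * m - N)"
    proof -
      have "0 \<le> b * (real t * (c * m - N))" using b False by (intro mult_nonneg_nonneg) auto
      then show ?thesis by (simp add: algebra_simps)
    qed
    finally show ?case .
  qed simp
  from this[of T] nonneg[of T] have "real T * (c * m - N) \<le> (1 + b) ^ T * \<Delta> 0" by simp
  then show ?thesis using c T by (simp add: field_simps)
qed

lemma growth_factor_le_6:
  fixes b :: real
  assumes "b \<ge> 0" and "real T * b \<le> 3 / 2"
  shows "(1 + b) ^ T \<le> 6"
proof -
  have "(1 + b) ^ T \<le> exp b ^ T"
    using assms exp_ge_add_one_self[of b] by (intro power_mono) auto
  also have "\<dots> = exp (real T * b)" by (simp add: exp_of_nat_mult)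
  also have "\<dots> \<le> exp (3 / 2)" using assms by simp
  also have "\<dots> \<le> 6"
  proof (rule power2_le_imp_le)
    have "(exp (3 / 2 :: real))\<^sup>2 = exp 1 ^ 3"
      by (simp flip: exp_of_nat_mult)
    also have "\<dots> \<le> 3 ^ 3" using exp_le by (intro power_mono) auto
    finally show "(exp (3 / 2 :: real))\<^sup>2 \<le> 6\<^sup>2" by simp
  qed simp
  finally show ?thesis .
qed

section \<open>The rate for an admissible stepsize\<close>

text \<open>Square integrability of the starting point of a round is a premise, because it is only obtained
  along the way, by induction on the rounds.\<close>

lemma ABC_rounds:
  assumes "prob_space M" and nQ: "n \<ge> 1" "Q \<ge> 1" and CD: "C \<ge> 0" "D \<ge> 0" and a: "\<alpha> > 0"
    and smooth: "\<forall>i\<in>{1..n}. L_smooth L (f i) \<and> bdd_below (range (f i))"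
    and abc: "ABC M n Q f g \<xi>
         (\<lambda>i t l \<omega>. fedavg_local n Q (\<lambda>_. \<alpha>) g (\<lambda>i t l. \<xi> i t l \<omega>) x0 i t l) C D"
  obtains F where "\<And>t. sq_integrable M (\<lambda>\<omega>. fedavg n Q (\<lambda>_. \<alpha>) g (\<lambda>i t l. \<xi> i t l \<omega>) x0 t) \<Longrightarrow>
      fedavg_round M n Q L C D \<alpha> f (F t) (\<lambda>\<omega>. fedavg n Q (\<lambda>_. \<alpha>) g (\<lambda>i t l. \<xi> i t l \<omega>) x0 t)
        (\<lambda>i l \<omega>. fedavg_local n Q (\<lambda>_. \<alpha>) g (\<lambda>i t l. \<xi> i t l \<omega>) x0 i t l)
        (\<lambda>i l \<omega>. g i (fedavg_local n Q (\<lambda>_. \<alpha>) g (\<lambda>i t l. \<xi> i t l \<omega>) x0 i t l) (\<xi> i t l \<omega>))"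
proof -
  interpret prob_space M by fact
  let ?x = "\<lambda>i t l \<omega>. fedavg_local n Q (\<lambda>_. \<alpha>) g (\<lambda>i t l. \<xi> i t l \<omega>) x0 i t l"
  obtain F :: "nat \<Rightarrow> nat \<Rightarrow> 'a measure" where
    F1: "\<And>k l. l < Q \<Longrightarrow> subalgebra M (F k l)" and
    F2: "\<And>k l. Suc l < Q \<Longrightarrow> subalgebra (F k (Suc l)) (F k l)" and
    F3: "\<And>k i l. i \<in> {1..n} \<Longrightarrow> l < Q \<Longrightarrow> ?x i k l \<in> borel_measurable (F k l)" and
    F4: "\<And>k i l. i \<in> {1..n} \<Longrightarrow> l < Q \<Longrightarrow> abc_at M (F k l) C D (f i) (g i) (\<xi> i k l) (?x i k l)" and
    F5: "\<And>k l. l < Q \<Longrightarrow> cond_indep_vars M (F k l) {1..n} (\<lambda>i \<omega>. g i (?x i k l \<omega>) (\<xi> i k l \<omega>))"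
    using abc unfolding ABC_def
    apply (elim exE conjE)
    subgoal for F by (rule that[of F]; blast)
    done
  show ?thesis
  proof (rule that[of F])
    fix t assume sq: "sq_integrable M (\<lambda>\<omega>. fedavg n Q (\<lambda>_. \<alpha>) g (\<lambda>i t l. \<xi> i t l \<omega>) x0 t)"
    show "fedavg_round M n Q L C D \<alpha> f (F t) (\<lambda>\<omega>. fedavg n Q (\<lambda>_. \<alpha>) g (\<lambda>i t l. \<xi> i t l \<omega>) x0 t)
        (\<lambda>i l \<omega>. ?x i t l \<omega>) (\<lambda>i l \<omega>. g i (?x i t l \<omega>) (\<xi> i t l \<omega>))"
    proof
      fix i l assume i: "i \<in> {1..n}" and l: "l < Q"
      note abc_at = F4[OF i l, of t, unfolded abc_at_def]
      show "(\<lambda>\<omega>. g i (?x i t l \<omega>) (\<xi> i t l \<omega>)) \<in> borel_measurable M"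
        using abc_at by (elim conjE)
      show "AE \<omega> in M. vec_cond_exp M (F t l) (\<lambda>\<omega>. g i (?x i t l \<omega>) (\<xi> i t l \<omega>)) \<omega>
          = grad (f i) (?x i t l \<omega>)"
        using abc_at by (elim conjE)
      show "AE \<omega> in M. nn_cond_exp M (F t l)
            (\<lambda>\<omega>. ennreal ((norm (g i (?x i t l \<omega>) (\<xi> i t l \<omega>) - grad (f i) (?x i t l \<omega>)))\<^sup>2)) \<omega>
          \<le> ennreal (C * (f i (?x i t l \<omega>) - inf_val (f i)) + D)"
        using abc_at by (elim conjE)
    qed (use nQ CD a smooth F1 F2 F3 F5 sq in \<open>auto simp: fedavg_local_def\<close>)
  qed
qed

lemma avg_obj_recursion:
  assumes "prob_space M" and nQ: "n \<ge> 1" "Q \<ge> 1" and CD: "C \<ge> 0" "D \<ge> 0" and a: "\<alpha> > 0"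
    and smooth: "\<forall>i\<in>{1..n}. L_smooth L (f i) \<and> bdd_below (range (f i))"
    and abc: "ABC M n Q f g \<xi>
         (\<lambda>i t l \<omega>. fedavg_local n Q (\<lambda>_. \<alpha>) g (\<lambda>i t l. \<xi> i t l \<omega>) x0 i t l) C D"
    and small: "2 * \<alpha> * L * real Q \<le> 1"
    and small': "Q \<ge> 2 \<Longrightarrow> 1 + 2 * (\<alpha> * C / real n)
        \<le> 4 * (1 - (2 * \<alpha>\<^sup>2 * real Q * C * L + 2 * \<alpha>\<^sup>2 * (real Q)\<^sup>2 * L\<^sup>2))"
  defines "X \<equiv> \<lambda>t \<omega>. fedavg n Q (\<lambda>_. \<alpha>) g (\<lambda>i t l. \<xi> i t l \<omega>) x0 t"
    and "\<Delta> \<equiv> \<lambda>t. \<integral>\<omega>. avg_obj n f (fedavg n Q (\<lambda>_. \<alpha>) g (\<lambda>i t l. \<xi> i t l \<omega>) x0 t)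
        - inf_val (avg_obj n f) \<partial>M"
  shows "sq_integrable M (X t)"
    and "\<Delta> (Suc t) \<le> \<Delta> t - \<alpha> * real Q / 2 * (\<integral>\<omega>. (norm (grad (avg_obj n f) (X t \<omega>)))\<^sup>2 \<partial>M)
      + 2 * \<alpha> * L\<^sup>2 * (\<alpha>\<^sup>2 * (real Q)\<^sup>2 * (2 * C * (\<Delta> t + sigma_star n f) + D)
          + 4 * \<alpha>\<^sup>2 * real Q ^ 3 * L * (\<Delta> t + sigma_star n f))
      + L * \<alpha>\<^sup>2 * real Q / real n * (2 * C * (\<Delta> t + sigma_star n f) + D)"
proof -
  interpret prob_space M by fact
  obtain F where round: "\<And>t. sq_integrable M (X t) \<Longrightarrow>
      fedavg_round M n Q L C D \<alpha> f (F t) (X t)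
        (\<lambda>i l \<omega>. fedavg_local n Q (\<lambda>_. \<alpha>) g (\<lambda>i t l. \<xi> i t l \<omega>) x0 i t l)
        (\<lambda>i l \<omega>. g i (fedavg_local n Q (\<lambda>_. \<alpha>) g (\<lambda>i t l. \<xi> i t l \<omega>) x0 i t l) (\<xi> i t l \<omega>))"
    unfolding X_def using ABC_rounds[OF assms(1-8)] by blast
  have nxt: "fedavg_round.next_iterate n Q
      (\<lambda>i l \<omega>. fedavg_local n Q (\<lambda>_. \<alpha>) g (\<lambda>i t l. \<xi> i t l \<omega>) x0 i t l) = X (Suc t)"
    if "sq_integrable M (X t)" for t
    unfolding fedavg_round.next_iterate_def[OF round[OF that], abs_def] X_def
    by (simp add: fedavg_local_def)
  show sq: "sq_integrable M (X t)" for t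
  proof (induction t)
    case 0
    then show ?case by (simp add: X_def sq_integrable_const)
  next
    case (Suc t)
    then show ?case
      using fedavg_round.next_iterate_sq_integrable[OF round] nxt by metis
  qed
  show "\<Delta> (Suc t) \<le> \<Delta> t - \<alpha> * real Q / 2 * (\<integral>\<omega>. (norm (grad (avg_obj n f) (X t \<omega>)))\<^sup>2 \<partial>M)
      + 2 * \<alpha> * L\<^sup>2 * (\<alpha>\<^sup>2 * (real Q)\<^sup>2 * (2 * C * (\<Delta> t + sigma_star n f) + D)
          + 4 * \<alpha>\<^sup>2 * real Q ^ 3 * L * (\<Delta> t + sigma_star n f))
      + L * \<alpha>\<^sup>2 * real Q / real n * (2 * C * (\<Delta> t + sigma_star n f) + D)"
    using fedavg_round.round_recursion[OF round[OF sq] small small', unfolded nxt[OF sq]]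
    unfolding \<Delta>_def X_def by simp
qed

text \<open>Here b is the factor of \<open>\<Delta> t\<close> and N the constant part when the recursion is expanded with
  \<open>\<Psi> = \<Delta> t + \<sigma>\<close>.  The first and the second bound on the stepsize give \<open>T b \<le> 3 / 2\<close>, so that
  \<open>(1 + b)\<^sup>T \<le> e\<^sup>3\<^sup>/\<^sup>2 < 6\<close>, and division by \<open>\<alpha> Q / 2\<close> produces the factor 12.\<close>

lemma fedavg_min_grad_bound:
  fixes x0 :: "real^'p"
  assumes prob: "prob_space M" and nQ: "n \<ge> 1" "Q \<ge> 1" and CD: "C \<ge> 0" "D \<ge> 0" and a: "\<alpha> > 0"
    and smooth: "\<forall>i\<in>{1..n}. L_smooth L (f i) \<and> bdd_below (range (f i))"
    and abc: "ABC M n Q f g \<xi>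
         (\<lambda>i t l \<omega>. fedavg_local n Q (\<lambda>_. \<alpha>) g (\<lambda>i t l. \<xi> i t l \<omega>) x0 i t l) C D"
    and T: "T \<ge> 1" and le: "ereal \<alpha> \<le> stepsize_bound n Q T C L"
  defines "r \<equiv> \<lambda>t. \<integral>\<omega>. (norm (grad (avg_obj n f)
        (fedavg n Q (\<lambda>_. \<alpha>) g (\<lambda>i t l. \<xi> i t l \<omega>) x0 t)))\<^sup>2 \<partial>M"
  shows "\<forall>t<T. integrable M
          (\<lambda>\<omega>. (norm (grad (avg_obj n f) (fedavg n Q (\<lambda>_. \<alpha>) g (\<lambda>i t l. \<xi> i t l \<omega>) x0 t)))\<^sup>2)"
    and "(MIN t\<in>{0..T-1}. r t)
       \<le> 12 * (avg_obj n f x0 - inf_val (avg_obj n f)) / (\<alpha> * real Q * real T)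
         + 2 * \<alpha> * L / real n * (D + 2 * C * sigma_star n f)
         + 4 * \<alpha>\<^sup>2 * real Q * L\<^sup>2 * D
         + 8 * \<alpha>\<^sup>2 * L\<^sup>2 * (real Q)\<^sup>2 * (3 * L + 2 * C) * sigma_star n f"
proof -
  interpret prob_space M by fact
  have sm: "\<forall>i\<in>{1..n}. L_smooth L (f i)" and bd: "\<forall>i\<in>{1..n}. bdd_below (range (f i))"
    using smooth by auto
  have L: "L \<ge> 0" using sm nQ L_smooth_nonneg[of L "f 1"] by simp
  have n0: "real n \<ge> 1" and Q1: "real Q \<ge> 1" and T1: "real T \<ge> 1" using nQ T by auto
  define \<sigma> where "\<sigma> = sigma_star n f"
  have \<sigma>: "\<sigma> \<ge> 0" unfolding \<sigma>_def by (rule sigma_star_nonneg[OF bd])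
  note st = le_stepsize_boundD[OF nQ T CD(1) L a le]
  have cube: "42 * (\<alpha> * L * real Q) ^ 3 \<le> 1"
  proof -
    have "42 * (\<alpha> * L * real Q) ^ 3 = 14 * \<alpha> ^ 3 * real Q ^ 3 * L\<^sup>2 * (3 * L) * 1"
      by (simp add: power3_eq_cube power2_eq_square algebra_simps)
    also have "\<dots> \<le> 14 * \<alpha> ^ 3 * real Q ^ 3 * L\<^sup>2 * (2 * C + 3 * L) * real T"
      using CD a L T1 by (intro mult_mono) auto
    finally show ?thesis using st(2) by (rule order_trans)
  qed
  (* The second stepsize bound alone limits the length of the local path. *)
  have small: "2 * \<alpha> * L * real Q \<le> 1"
  proof (rule ccontr)
    assume "\<not> ?thesis"
    then have "(1 / 2) ^ 3 < (\<alpha> * L * real Q) ^ 3" by (intro power_strict_mono) auto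
    then show False using cube by (simp add: power3_eq_cube)
  qed
  have small': "1 + 2 * (\<alpha> * C / real n)
        \<le> 4 * (1 - (2 * \<alpha>\<^sup>2 * real Q * C * L + 2 * \<alpha>\<^sup>2 * (real Q)\<^sup>2 * L\<^sup>2))" if "Q \<ge> 2"
  proof (rule stepsize_drift_condition[OF a CD(1) L _ n0 _ cube])
    (* The factor 2 is a lower bound for the number of local steps. *)
    have "2 * (\<alpha> * C)\<^sup>2 \<le> \<alpha>\<^sup>2 * (real Q * (C\<^sup>2 + L\<^sup>2) * real T)"
    proof -
      have "\<alpha>\<^sup>2 * (2 * C\<^sup>2 * 1) \<le> \<alpha>\<^sup>2 * (real Q * (C\<^sup>2 + L\<^sup>2) * real T)"
        using that T1 by (intro mult_mono mult_left_mono) auto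
      then show ?thesis by (simp add: power_mult_distrib)
    qed
    with st(1) have "2 * (\<alpha> * C)\<^sup>2 \<le> real n" by simp
    also have "\<dots> \<le> (real n)\<^sup>2" using n0 by (simp add: power2_eq_square)
    finally show "2 * (\<alpha> * C / real n)\<^sup>2 \<le> 1" using n0 by (simp add: power_divide)
    show "8 * (\<alpha> * C) * (\<alpha> * L * real Q) \<le> 1"
      using st(4) by (simp add: power2_eq_square algebra_simps)
  qed simp
  define X where "X = (\<lambda>t \<omega>. fedavg n Q (\<lambda>_. \<alpha>) g (\<lambda>i t l. \<xi> i t l \<omega>) x0 t)"
  define \<Delta> where "\<Delta> = (\<lambda>t. \<integral>\<omega>. avg_obj n f (X t \<omega>) - inf_val (avg_obj n f) \<partial>M)"
  note rec = avg_obj_recursion[OF prob nQ CD a smooth abc small small', folded \<sigma>_def]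
  have sq: "sq_integrable M (X t)" for t unfolding X_def by (rule rec(1))
  have smA: "L_smooth L (avg_obj n f)" and bdA: "bdd_below (range (avg_obj n f))"
    using L_smooth_avg_obj[OF sm nQ(1)] bdd_below_avg_obj[OF bd] .
  show "\<forall>t<T. integrable M
      (\<lambda>\<omega>. (norm (grad (avg_obj n f) (fedavg n Q (\<lambda>_. \<alpha>) g (\<lambda>i t l. \<xi> i t l \<omega>) x0 t)))\<^sup>2)"
    using sq_integrableD(2)[OF sq_integrable_grad[OF smA sq]] unfolding X_def by simp
  have \<Delta>0: "\<Delta> t \<ge> 0" for t
    unfolding \<Delta>_def using inf_val_le[OF bdA] by (intro integral_nonneg_AE) auto
  define b where "b = 2 * \<alpha> * L\<^sup>2 * (2 * \<alpha>\<^sup>2 * (real Q)\<^sup>2 * C + 4 * \<alpha>\<^sup>2 * real Q ^ 3 * L)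
      + 2 * L * \<alpha>\<^sup>2 * real Q * C / real n"
  define N where "N = b * \<sigma> + 2 * \<alpha> ^ 3 * L\<^sup>2 * (real Q)\<^sup>2 * D + L * \<alpha>\<^sup>2 * real Q * D / real n"
  have b0: "b \<ge> 0" unfolding b_def using a L CD by simp
  have step: "\<Delta> (Suc t) \<le> (1 + b) * \<Delta> t - \<alpha> * real Q / 2 * r t + N" for t
  proof -
    have "2 * \<alpha> * L\<^sup>2 * (\<alpha>\<^sup>2 * (real Q)\<^sup>2 * (2 * C * p + D) + 4 * \<alpha>\<^sup>2 * real Q ^ 3 * L * p)
        + L * \<alpha>\<^sup>2 * real Q / real n * (2 * C * p + D)
        = b * p + 2 * \<alpha> ^ 3 * L\<^sup>2 * (real Q)\<^sup>2 * D + L * \<alpha>\<^sup>2 * real Q * D / real n" for p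
      unfolding b_def using n0 by (simp add: field_simps power2_eq_square power3_eq_cube)
    from this[of "\<Delta> t + \<sigma>"] rec(2)[of t] show ?thesis
      unfolding N_def \<Delta>_def X_def r_def by (simp add: distrib_left distrib_right)
  qed
  have bT: "real T * b \<le> 3 / 2"
  proof -
    have "2 * (L * C) \<le> C\<^sup>2 + L\<^sup>2" using sum_squares_bound[of L C] by simp
    then have "\<alpha>\<^sup>2 * (real Q * (2 * (L * C)) * real T) \<le> \<alpha>\<^sup>2 * (real Q * (C\<^sup>2 + L\<^sup>2) * real T)"
      by (intro mult_left_mono mult_right_mono) auto
    with st(1) have "\<alpha>\<^sup>2 * (real Q * (2 * (L * C)) * real T) \<le> real n" by simp
    then have 1: "real T * (2 * L * \<alpha>\<^sup>2 * real Q * C / real n) \<le> 1"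
      using n0 by (simp add: field_simps)
    have "real T * (2 * \<alpha> * L\<^sup>2 * (2 * \<alpha>\<^sup>2 * (real Q)\<^sup>2 * C + 4 * \<alpha>\<^sup>2 * real Q ^ 3 * L))
        = (\<alpha> ^ 3 * L\<^sup>2 * real T) * (4 * ((real Q)\<^sup>2 * C) + 8 * (real Q ^ 3 * L))"
      by (simp add: power2_eq_square power3_eq_cube algebra_simps)
    also have "\<dots> \<le> (\<alpha> ^ 3 * L\<^sup>2 * real T) * (7 * (real Q ^ 3 * (2 * C + 3 * L)))"
    proof (intro mult_left_mono)
      have "(real Q)\<^sup>2 * C \<le> real Q ^ 3 * C"
        using Q1 CD by (intro mult_right_mono power_increasing) auto
      moreover have "0 \<le> real Q ^ 3 * C" "0 \<le> real Q ^ 3 * L" using CD L by auto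
      ultimately show "4 * ((real Q)\<^sup>2 * C) + 8 * (real Q ^ 3 * L) \<le> 7 * (real Q ^ 3 * (2 * C + 3 * L))"
        by (simp add: algebra_simps)
    qed (use a in auto)
    also have "\<dots> = 14 * \<alpha> ^ 3 * real Q ^ 3 * L\<^sup>2 * (2 * C + 3 * L) * real T / 2"
      by (simp add: algebra_simps)
    also have "\<dots> \<le> 1 / 2" by (rule divide_right_mono[OF st(2)]) simp
    finally show ?thesis using 1 unfolding b_def by (simp add: distrib_left)
  qed
  define m where "m = (MIN t\<in>{0..T-1}. r t)"
  have m: "m \<le> r t" if "t < T" for t
    unfolding m_def using that by (intro Min_le) auto
  have c: "\<alpha> * real Q / 2 > 0" using a Q1 by simp
  have "m \<le> (1 + b) ^ T * \<Delta> 0 / (\<alpha> * real Q / 2 * real T) + N / (\<alpha> * real Q / 2)"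
    by (rule perturbed_recursion_bound[of T \<Delta> b "\<alpha> * real Q / 2" r N m])
      (use step \<Delta>0 b0 c T m in blast)+
  also have "\<dots> \<le> 6 * \<Delta> 0 / (\<alpha> * real Q / 2 * real T) + N / (\<alpha> * real Q / 2)"
    using growth_factor_le_6[OF b0 bT] \<Delta>0[of 0] c
    by (intro add_right_mono divide_right_mono mult_right_mono) auto
  also have "6 * \<Delta> 0 / (\<alpha> * real Q / 2 * real T)
      = 12 * (avg_obj n f x0 - inf_val (avg_obj n f)) / (\<alpha> * real Q * real T)"
    by (simp add: \<Delta>_def X_def prob_space)
  also have "N / (\<alpha> * real Q / 2) = 2 * \<alpha> * L / real n * (D + 2 * C * \<sigma>)
      + 4 * \<alpha>\<^sup>2 * real Q * L\<^sup>2 * D + 8 * \<alpha>\<^sup>2 * L\<^sup>2 * (real Q * C + 2 * (real Q)\<^sup>2 * L) * \<sigma>"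
    unfolding N_def b_def using a n0 Q1 by (simp add: field_simps power2_eq_square power3_eq_cube)
  also have "8 * \<alpha>\<^sup>2 * L\<^sup>2 * (real Q * C + 2 * (real Q)\<^sup>2 * L) * \<sigma>
      \<le> 8 * \<alpha>\<^sup>2 * L\<^sup>2 * ((real Q)\<^sup>2 * (3 * L + 2 * C)) * \<sigma>"
  proof (intro mult_right_mono mult_left_mono)
    have "real Q * C \<le> (real Q)\<^sup>2 * C"
      using Q1 CD by (intro mult_right_mono) (auto simp: power2_eq_square)
    moreover have "0 \<le> (real Q)\<^sup>2 * C" "0 \<le> (real Q)\<^sup>2 * L" using CD L by auto
    ultimately show "real Q * C + 2 * (real Q)\<^sup>2 * L \<le> (real Q)\<^sup>2 * (3 * L + 2 * C)"
      by (simp add: algebra_simps)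
  qed (use \<sigma> in auto)
  finally show "(MIN t\<in>{0..T-1}. r t)
       \<le> 12 * (avg_obj n f x0 - inf_val (avg_obj n f)) / (\<alpha> * real Q * real T)
         + 2 * \<alpha> * L / real n * (D + 2 * C * sigma_star n f)
         + 4 * \<alpha>\<^sup>2 * real Q * L\<^sup>2 * D
         + 8 * \<alpha>\<^sup>2 * L\<^sup>2 * (real Q)\<^sup>2 * (3 * L + 2 * C) * sigma_star n f"
    unfolding m_def \<sigma>_def by (simp add: mult.assoc)
qed

section \<open>The rate for the tuned stepsize\<close>

definition tuned_denominator :: "nat \<Rightarrow> nat \<Rightarrow> real \<Rightarrow> real \<Rightarrow> nat \<Rightarrow> real" where
  "tuned_denominator n Q C L T =
     sqrt (real Q * (L\<^sup>2 + C\<^sup>2) * real T / real n) + gamma_const Q T C L"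

lemma le_top_if_zero: "(d \<noteq> 0 \<Longrightarrow> a \<le> v) \<Longrightarrow> ereal a \<le> top_if_zero d v"
  by (simp add: top_if_zero_def)

lemma tuned_stepsize_le_bound:
  assumes "n \<ge> 1" and C: "C \<ge> 0" and L: "L \<ge> 0"
  shows "ereal (1 / tuned_denominator n Q C L T) \<le> stepsize_bound n Q T C L"
proof -
  define s where "s = sqrt (real Q * (L\<^sup>2 + C\<^sup>2) * real T / real n)"
  define z where "z = 14 * real Q ^ 3 * L\<^sup>2 * (2 * C + 3 * L) * real T"
  define w where "w = 2 * sqrt (2 * real Q * C * L)"
  have z0: "z \<ge> 0" unfolding z_def using C L by simp
  have nonneg: "s \<ge> 0" "root 3 z \<ge> 0" "w \<ge> 0"
    unfolding s_def w_def using z0 C L by auto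
  have d: "tuned_denominator n Q C L T = s + C + root 3 z + w"
    unfolding tuned_denominator_def gamma_const_def s_def z_def w_def by simp
  have part: "1 / tuned_denominator n Q C L T \<le> 1 / q"
    if "q \<noteq> 0" "q \<in> {s, C, root 3 z, w}" for q
  proof -
    have "q \<ge> 0" "q \<le> s + C + root 3 z + w" using that(2) nonneg C by auto
    then show ?thesis unfolding d using that(1) by (intro divide_left_mono mult_pos_pos) auto
  qed
  have s_eq: "sqrt (real n / (real Q * (C\<^sup>2 + L\<^sup>2) * real T)) = 1 / s"
    unfolding s_def by (simp add: real_sqrt_divide add.commute)
  show ?thesis
    unfolding stepsize_bound_def le_Min_four_iff
  proof (intro conjI le_top_if_zero)
    assume "real Q * (C\<^sup>2 + L\<^sup>2) * real T \<noteq> 0"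
    then have "s \<noteq> 0" unfolding s_def using assms(1) by (simp add: add.commute)
    then show "1 / tuned_denominator n Q C L T \<le> sqrt (real n / (real Q * (C\<^sup>2 + L\<^sup>2) * real T))"
      unfolding s_eq by (intro part) auto
  next
    assume "14 * real Q ^ 3 * L\<^sup>2 * (2 * C + 3 * L) * real T \<noteq> 0"
    then show "1 / tuned_denominator n Q C L T
        \<le> root 3 (1 / (14 * real Q ^ 3 * L\<^sup>2 * (2 * C + 3 * L) * real T))"
      using part[of "root 3 z"] unfolding z_def[symmetric] by (simp add: real_root_divide)
  next
    assume "C \<noteq> 0"
    then show "1 / tuned_denominator n Q C L T \<le> 1 / C" by (intro part) auto
  next
    assume "2 * sqrt (2 * real Q * C * L) \<noteq> 0"
    then show "1 / tuned_denominator n Q C L T \<le> 1 / (2 * sqrt (2 * real Q * C * L))"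
      unfolding w_def[symmetric] by (intro part) auto
  qed
qed

text \<open>The term under the square root is the only one that grows as fast as \<open>\<surd>T\<close>.\<close>

lemma tuned_denominator_order:
  assumes T: "T \<ge> 1" and C: "C \<ge> 0" and L: "L \<ge> 0"
  shows "tuned_denominator n Q C L T \<le> tuned_denominator n Q C L 1 * sqrt (real T)"
    and "sqrt (real Q * (L\<^sup>2 + C\<^sup>2) / real n) * sqrt (real T) \<le> tuned_denominator n Q C L T"
proof -
  define s where "s = sqrt (real Q * (L\<^sup>2 + C\<^sup>2) / real n)"
  define z where "z = 14 * real Q ^ 3 * L\<^sup>2 * (2 * C + 3 * L)"
  define w where "w = 2 * sqrt (2 * real Q * C * L)"
  have z0: "z \<ge> 0" unfolding z_def using C L by simp
  have nonneg: "s \<ge> 0" "root 3 z \<ge> 0" "w \<ge> 0" unfolding s_def w_def using z0 C L by auto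
  have d: "tuned_denominator n Q C L t = s * sqrt (real t) + (C + root 3 z * root 3 (real t) + w)" for t
    unfolding tuned_denominator_def gamma_const_def s_def z_def w_def
    by (simp flip: real_sqrt_mult real_root_mult)
  have one: "1 \<le> sqrt (real T)" using T by simp
  have root: "root 3 (real T) \<le> sqrt (real T)"
    unfolding sqrt_def using T by (intro real_root_decreasing) auto
  have "C * 1 \<le> C * sqrt (real T)" "w * 1 \<le> w * sqrt (real T)"
      "root 3 z * root 3 (real T) \<le> root 3 z * sqrt (real T)"
    using one root nonneg C by (intro mult_left_mono; simp)+
  then show "tuned_denominator n Q C L T \<le> tuned_denominator n Q C L 1 * sqrt (real T)"
    unfolding d by (simp add: distrib_right)
  have "0 \<le> root 3 z * root 3 (real T)" using nonneg by simp
  then show "sqrt (real Q * (L\<^sup>2 + C\<^sup>2) / real n) * sqrt (real T) \<le> tuned_denominator n Q C L T"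
    unfolding s_def[symmetric] d using nonneg C by simp
qed

lemma sqrt_le_of_nat: "T \<ge> 1 \<Longrightarrow> sqrt (real T) \<le> real T"
  by (intro real_le_lsqrt) (auto simp: power2_eq_square)

text \<open>The stepsize is of exact order \<open>1 / \<surd>T\<close>.  The initial gap and the variance term then decay like
  \<open>1 / \<surd>T\<close>; the heterogeneity \<open>\<sigma>\<close> also enters without the factor C, but only in a term of order
  \<open>\<alpha>\<^sup>2\<close>, that is \<open>1 / T\<close>.\<close>

lemma tuned_bound_order:
  assumes "n \<ge> 1" "Q \<ge> 1" and C: "C \<ge> 0" and L: "L \<ge> 0"
    and nonneg: "\<delta> \<ge> 0" "D \<ge> 0" "\<sigma> \<ge> 0" and pos: "L\<^sup>2 + C\<^sup>2 > 0"
  obtains K where "K \<ge> 0" and "\<And>T a. T \<ge> 1 \<Longrightarrow> a = 1 / tuned_denominator n Q C L T \<Longrightarrow>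
      12 * \<delta> / (a * real Q * real T) + 2 * a * L / real n * (D + 2 * C * \<sigma>)
        + 4 * a\<^sup>2 * real Q * L\<^sup>2 * D + 8 * a\<^sup>2 * L\<^sup>2 * (real Q)\<^sup>2 * (3 * L + 2 * C) * \<sigma>
      \<le> K * ((\<delta> + D + C * \<sigma>) / sqrt (real T) + \<sigma> / real T)"
proof -
  define s where "s = sqrt (real Q * (L\<^sup>2 + C\<^sup>2) / real n)"
  define d where "d = tuned_denominator n Q C L 1"
  have n0: "real n > 0" and Q0: "real Q > 0" using assms by auto
  have s: "s > 0" unfolding s_def using n0 Q0 pos by simp
  define K1 where "K1 = 12 * d / real Q"
  define K2 where "K2 = 4 * L / (real n * s)"
  define K3 where "K3 = 4 * real Q * L\<^sup>2 / s\<^sup>2"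
  define K4 where "K4 = 8 * L\<^sup>2 * (real Q)\<^sup>2 * (3 * L + 2 * C) / s\<^sup>2"
  have "s * sqrt (real 1) \<le> d"
    unfolding s_def d_def by (rule tuned_denominator_order(2)) (use C L in auto)
  then have d: "d > 0" using s by simp
  have K: "K1 \<ge> 0" "K2 \<ge> 0" "K3 \<ge> 0" "K4 \<ge> 0"
    unfolding K1_def K2_def K3_def K4_def using d s C L by auto
  show ?thesis
  proof (rule that[of "K1 + K2 + K3 + K4"])
    show "K1 + K2 + K3 + K4 \<ge> 0" using K by simp
    fix T a assume T: "T \<ge> (1::nat)" and a: "a = 1 / tuned_denominator n Q C L T"
    let ?r = "sqrt (real T)"
    have r: "?r \<ge> 1" "?r * ?r = real T" using T by auto
    then have r0: "?r > 0" by linarith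
    define q where "q = tuned_denominator n Q C L T"
    have q: "q \<le> d * ?r" "s * ?r \<le> q"
      unfolding q_def d_def s_def using tuned_denominator_order[OF T C L] by auto
    have q0: "q > 0" using q(2) s r0 mult_pos_pos[OF s r0] by linarith
    have a0: "a > 0" using q0 unfolding a q_def by simp
    have a_le: "a \<le> 1 / (s * ?r)"
      unfolding a q_def[symmetric] using q(2) q0 s r0 by (intro divide_left_mono) auto
    have "a\<^sup>2 \<le> (1 / (s * ?r))\<^sup>2" using a_le a0 by (intro power_mono) auto
    also have "\<dots> = 1 / (s\<^sup>2 * real T)" by (simp add: power_divide power_mult_distrib)
    finally have a2: "a\<^sup>2 \<le> 1 / (s\<^sup>2 * real T)" .
    have Tr: "1 / real T \<le> 1 / ?r"
      using sqrt_le_of_nat[OF T] T by (intro divide_left_mono) auto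
    have "12 * \<delta> / (a * real Q * real T) = 12 * \<delta> / (real Q * real T) * q"
      unfolding a q_def by simp
    also have "\<dots> \<le> 12 * \<delta> / (real Q * real T) * (d * ?r)"
      using q(1) nonneg by (intro mult_left_mono) auto
    also have "\<dots> = K1 * \<delta> * (?r / real T)" unfolding K1_def by simp
    also have "?r / real T = 1 / ?r" using r0 T by (simp add: field_simps)
    also have "K1 * \<delta> * (1 / ?r) = K1 * (\<delta> / ?r)" by simp
    finally have 1: "12 * \<delta> / (a * real Q * real T) \<le> K1 * (\<delta> / ?r)" .
    have "2 * a * L / real n * (D + 2 * C * \<sigma>) \<le> 2 * (1 / (s * ?r)) * L / real n * (2 * (D + C * \<sigma>))"
      using a_le a0 L C nonneg n0 s r0
      by (intro mult_mono divide_right_mono mult_right_mono) auto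
    also have "2 * (1 / (s * ?r)) * L / real n * (2 * p) = K2 * (p / ?r)" for p
      unfolding K2_def by (simp add: field_simps)
    finally have 2: "2 * a * L / real n * (D + 2 * C * \<sigma>) \<le> K2 * ((D + C * \<sigma>) / ?r)" .
    have "4 * a\<^sup>2 * real Q * L\<^sup>2 * D = (4 * real Q * L\<^sup>2 * D) * a\<^sup>2" by simp
    also have "\<dots> \<le> (4 * real Q * L\<^sup>2 * D) * (1 / (s\<^sup>2 * real T))"
      using a2 nonneg by (intro mult_left_mono) auto
    also have "\<dots> = (K3 * D) * (1 / real T)" unfolding K3_def by simp
    also have "\<dots> \<le> (K3 * D) * (1 / ?r)"
      using Tr K nonneg by (intro mult_left_mono) auto
    finally have 3: "4 * a\<^sup>2 * real Q * L\<^sup>2 * D \<le> K3 * (D / ?r)" by simp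
    have "8 * a\<^sup>2 * L\<^sup>2 * (real Q)\<^sup>2 * (3 * L + 2 * C) * \<sigma>
        = (8 * L\<^sup>2 * (real Q)\<^sup>2 * (3 * L + 2 * C) * \<sigma>) * a\<^sup>2" by simp
    also have "\<dots> \<le> (8 * L\<^sup>2 * (real Q)\<^sup>2 * (3 * L + 2 * C) * \<sigma>) * (1 / (s\<^sup>2 * real T))"
      using a2 nonneg C L by (intro mult_left_mono) auto
    also have "\<dots> = K4 * (\<sigma> / real T)" unfolding K4_def by simp
    finally have 4: "8 * a\<^sup>2 * L\<^sup>2 * (real Q)\<^sup>2 * (3 * L + 2 * C) * \<sigma> \<le> K4 * (\<sigma> / real T)" .
    define u where "u = (\<delta> + D + C * \<sigma>) / ?r"
    define v where "v = \<sigma> / real T"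
    have u: "\<delta> / ?r \<le> u" "(D + C * \<sigma>) / ?r \<le> u" "D / ?r \<le> u"
      unfolding u_def using nonneg C r0 by (auto intro!: divide_right_mono)
    have uv0: "u \<ge> 0" "v \<ge> 0" unfolding u_def v_def using nonneg C by auto
    have "K1 * (\<delta> / ?r) \<le> K1 * u" "K2 * ((D + C * \<sigma>) / ?r) \<le> K2 * u" "K3 * (D / ?r) \<le> K3 * u"
      by (intro mult_left_mono u K)+
    moreover have "0 \<le> K1 * v" "0 \<le> K2 * v" "0 \<le> K3 * v" "0 \<le> K4 * u"
      using K uv0 by auto
    ultimately show "12 * \<delta> / (a * real Q * real T) + 2 * a * L / real n * (D + 2 * C * \<sigma>)
        + 4 * a\<^sup>2 * real Q * L\<^sup>2 * D + 8 * a\<^sup>2 * L\<^sup>2 * (real Q)\<^sup>2 * (3 * L + 2 * C) * \<sigma>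
      \<le> (K1 + K2 + K3 + K4) * ((\<delta> + D + C * \<sigma>) / sqrt (real T) + \<sigma> / real T)"
      using 1 2 3 4 unfolding u_def[symmetric] v_def[symmetric] by (simp add: distrib_left distrib_right)
  qed
qed

text \<open>If \<open>D + C \<sigma> > 0\<close>, then the first rate is of exact order \<open>1 / \<surd>T\<close> and dominates everything, with
  a constant that depends on the initial gap \<open>\<delta>\<close>.  The second rate keeps \<open>\<delta>\<close> visible and needs no
  such condition: when \<open>\<delta> + D + C \<sigma>\<close> vanishes, what remains is \<open>\<sigma> / T\<close>, and this is below
  \<open>\<sigma> / T\<^sup>2\<^sup>/\<^sup>3\<close>.\<close>

lemma bigo_rate_from_bound:
  fixes m :: "nat \<Rightarrow> real"
  assumes nQ: "n \<ge> 1" "Q \<ge> 1" and C: "C \<ge> 0" and K: "K \<ge> 0"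
    and nonneg: "\<delta> \<ge> 0" "D \<ge> 0" "\<sigma> \<ge> 0"
    and m: "\<And>T. T \<ge> 1 \<Longrightarrow> 0 \<le> m T"
      "\<And>T. T \<ge> 1 \<Longrightarrow> m T \<le> K * ((\<delta> + D + C * \<sigma>) / sqrt (real T) + \<sigma> / real T)"
  shows "D + C * \<sigma> > 0 \<Longrightarrow> m \<in> O(\<lambda>T. (D + C * \<sigma>) / sqrt (real n * real Q * real T)
               + real n * D / real T + (1 + C) * \<sigma> / real T powr (2 / 3))"
    and "m \<in> O(\<lambda>T. (\<delta> + D + C * \<sigma>) / sqrt (real n * real Q * real T)
               + real n * D / real T + (1 + C) * (\<delta> + \<sigma>) / real T powr (2 / 3))"
proof -
  define q where "q = sqrt (real n * real Q)"
  have "1 * 1 \<le> real n * real Q" using nQ by (intro mult_mono) auto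
  then have q: "q \<ge> 1" unfolding q_def by simp
  have sq: "sqrt (real n * real Q * real T) = q * sqrt (real T)" for T
    unfolding q_def by (simp add: real_sqrt_mult)
  show "m \<in> O(\<lambda>T. (\<delta> + D + C * \<sigma>) / sqrt (real n * real Q * real T)
               + real n * D / real T + (1 + C) * (\<delta> + \<sigma>) / real T powr (2 / 3))"
  proof (rule bigoI[of _ "K * q"], rule eventually_mono[OF eventually_ge_at_top[of 1]])
    fix T :: nat assume T: "T \<ge> 1"
    let ?u = "(\<delta> + D + C * \<sigma>) / sqrt (real n * real Q * real T)"
    let ?v = "(1 + C) * (\<delta> + \<sigma>) / real T powr (2 / 3)"
    have u: "(\<delta> + D + C * \<sigma>) / sqrt (real T) = q * ?u"
      unfolding sq using q by simp
    have "\<sigma> / real T \<le> ((1 + C) * (\<delta> + \<sigma>)) / real T powr (2 / 3)"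
    proof (rule frac_le)
      show "\<sigma> \<le> (1 + C) * (\<delta> + \<sigma>)" using nonneg C by (simp add: distrib_right distrib_left)
      show "real T powr (2 / 3) \<le> real T" using T powr_mono[of "2 / 3" 1 "real T"] by simp
    qed (use nonneg C T in auto)
    also have "\<dots> \<le> q * ?v" using q nonneg C mult_right_mono[of 1 q ?v] by simp
    finally have "K * ((\<delta> + D + C * \<sigma>) / sqrt (real T) + \<sigma> / real T) \<le> K * (q * ?u + q * ?v)"
      unfolding u using K by (intro mult_left_mono) auto
    also have "K * (q * ?u + q * ?v) = K * q * (?u + ?v)" by (simp only: distrib_left mult.assoc)
    also have "\<dots> \<le> K * q * (?u + real n * D / real T + ?v)"
      using K q nonneg by (intro mult_left_mono) auto
    finally show "norm (m T) \<le> K * q * norm (?u + real n * D / real T + ?v)"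
      using m[OF T] nonneg C by simp
  qed
  assume pos: "D + C * \<sigma> > 0"
  show "m \<in> O(\<lambda>T. (D + C * \<sigma>) / sqrt (real n * real Q * real T)
               + real n * D / real T + (1 + C) * \<sigma> / real T powr (2 / 3))"
  proof (rule bigoI[of _ "K * (\<delta> + D + C * \<sigma> + \<sigma>) * q / (D + C * \<sigma>)"],
      rule eventually_mono[OF eventually_ge_at_top[of 1]])
    fix T :: nat assume T: "T \<ge> 1"
    let ?u = "(D + C * \<sigma>) / sqrt (real n * real Q * real T)"
    let ?v = "(1 + C) * \<sigma> / real T powr (2 / 3)"
    let ?K = "K * (\<delta> + D + C * \<sigma> + \<sigma>) * q / (D + C * \<sigma>)"
    have "\<sigma> / real T \<le> \<sigma> / sqrt (real T)"
      using sqrt_le_of_nat[OF T] T nonneg by (intro divide_left_mono) auto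
    then have "K * ((\<delta> + D + C * \<sigma>) / sqrt (real T) + \<sigma> / real T)
        \<le> K * ((\<delta> + D + C * \<sigma>) / sqrt (real T) + \<sigma> / sqrt (real T))"
      using K by (intro mult_left_mono) auto
    also have "\<dots> = ?K * ?u"
    proof -
      have "q / (D + C * \<sigma>) * ?u = 1 / sqrt (real T)" unfolding sq using q pos by simp
      then have "K * (\<delta> + D + C * \<sigma> + \<sigma>) * (q / (D + C * \<sigma>) * ?u)
          = K * (\<delta> + D + C * \<sigma> + \<sigma>) * (1 / sqrt (real T))" by (rule arg_cong)
      then show ?thesis by (simp add: add_divide_distrib distrib_left)
    qed
    also have "\<dots> \<le> ?K * (?u + real n * D / real T + ?v)"
      using K q nonneg C pos by (intro mult_left_mono) auto
    finally show "norm (m T) \<le> ?K * norm (?u + real n * D / real T + ?v)"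
      using m[OF T] nonneg C by simp
  qed
qed

theorem theorem1:
  fixes n Q :: nat and L C D :: real
    and f :: "nat \<Rightarrow> real^'p \<Rightarrow> real"
    and g :: "nat \<Rightarrow> real^'p \<Rightarrow> 's \<Rightarrow> real^'p"
    and x0 :: "real^'p"
  assumes "n \<ge> 1" and "Q \<ge> 1" and "C \<ge> 0" and "D \<ge> 0"
    and "\<forall>i\<in>{1..n}. L_smooth L (f i) \<and> bdd_below (range (f i))"
  shows
    "(\<forall>(M :: 'a measure) (\<xi> :: nat \<Rightarrow> nat \<Rightarrow> nat \<Rightarrow> 'a \<Rightarrow> 's) (T :: nat) (\<alpha> :: real).
       prob_space M \<and> T \<ge> 1 \<and> \<alpha> > 0 \<and> ereal \<alpha> \<le> stepsize_bound n Q T C L \<and>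
       ABC M n Q f g \<xi>
         (\<lambda>i t l \<omega>. fedavg_local n Q (\<lambda>_. \<alpha>) g (\<lambda>i t l. \<xi> i t l \<omega>) x0 i t l) C D
       \<longrightarrow>
       (\<forall>t<T. integrable M
          (\<lambda>\<omega>. (norm (grad (avg_obj n f) (fedavg n Q (\<lambda>_. \<alpha>) g (\<lambda>i t l. \<xi> i t l \<omega>) x0 t)))\<^sup>2)) \<and>
       (MIN t\<in>{0..T-1}. \<integral>\<omega>.
          (norm (grad (avg_obj n f) (fedavg n Q (\<lambda>_. \<alpha>) g (\<lambda>i t l. \<xi> i t l \<omega>) x0 t)))\<^sup>2 \<partial>M)
       \<le> 12 * (avg_obj n f x0 - inf_val (avg_obj n f)) / (\<alpha> * real Q * real T)
         + 2 * \<alpha> * L / real n * (D + 2 * C * sigma_star n f)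
         + 4 * \<alpha>\<^sup>2 * real Q * L\<^sup>2 * D
         + 8 * \<alpha>\<^sup>2 * L\<^sup>2 * (real Q)\<^sup>2 * (3 * L + 2 * C) * sigma_star n f)
     \<and>
     (\<forall>(M :: nat \<Rightarrow> 'a measure) (\<xi> :: nat \<Rightarrow> nat \<Rightarrow> nat \<Rightarrow> nat \<Rightarrow> 'a \<Rightarrow> 's) (\<alpha> :: nat \<Rightarrow> real).
       (\<forall>T\<ge>1. prob_space (M T) \<and> \<alpha> T > 0 \<and>
          \<alpha> T = 1 / (sqrt (real Q * (L\<^sup>2 + C\<^sup>2) * real T / real n) + gamma_const Q T C L) \<and>
          ABC (M T) n Q f g (\<xi> T)
            (\<lambda>i t l \<omega>. fedavg_local n Q (\<lambda>_. \<alpha> T) g (\<lambda>i t l. \<xi> T i t l \<omega>) x0 i t l) C D)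
       \<longrightarrow>
       (D + C * sigma_star n f > 0 \<longrightarrow>
        (\<lambda>T. MIN t\<in>{0..T-1}. \<integral>\<omega>.
           (norm (grad (avg_obj n f) (fedavg n Q (\<lambda>_. \<alpha> T) g (\<lambda>i t l. \<xi> T i t l \<omega>) x0 t)))\<^sup>2 \<partial>(M T))
        \<in> O(\<lambda>T. (D + C * sigma_star n f) / sqrt (real n * real Q * real T)
               + real n * D / real T
               + (1 + C) * sigma_star n f / real T powr (2 / 3))) \<and>
       (\<lambda>T. MIN t\<in>{0..T-1}. \<integral>\<omega>.
          (norm (grad (avg_obj n f) (fedavg n Q (\<lambda>_. \<alpha> T) g (\<lambda>i t l. \<xi> T i t l \<omega>) x0 t)))\<^sup>2 \<partial>(M T))
       \<in> O(\<lambda>T. ((avg_obj n f x0 - inf_val (avg_obj n f)) + D + C * sigma_star n f)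
                 / sqrt (real n * real Q * real T)
              + real n * D / real T
              + (1 + C) * ((avg_obj n f x0 - inf_val (avg_obj n f)) + sigma_star n f)
                 / real T powr (2 / 3)))"
proof (rule conjI; intro allI impI)
  fix M :: "'a measure" and \<xi> :: "nat \<Rightarrow> nat \<Rightarrow> nat \<Rightarrow> 'a \<Rightarrow> 's" and T :: nat and \<alpha> :: real
  assume asm: "prob_space M \<and> T \<ge> 1 \<and> \<alpha> > 0 \<and> ereal \<alpha> \<le> stepsize_bound n Q T C L \<and>
       ABC M n Q f g \<xi>
         (\<lambda>i t l \<omega>. fedavg_local n Q (\<lambda>_. \<alpha>) g (\<lambda>i t l. \<xi> i t l \<omega>) x0 i t l) C D"
  show "(\<forall>t<T. integrable M
          (\<lambda>\<omega>. (norm (grad (avg_obj n f) (fedavg n Q (\<lambda>_. \<alpha>) g (\<lambda>i t l. \<xi> i t l \<omega>) x0 t)))\<^sup>2)) \<and>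
       (MIN t\<in>{0..T-1}. \<integral>\<omega>.
          (norm (grad (avg_obj n f) (fedavg n Q (\<lambda>_. \<alpha>) g (\<lambda>i t l. \<xi> i t l \<omega>) x0 t)))\<^sup>2 \<partial>M)
       \<le> 12 * (avg_obj n f x0 - inf_val (avg_obj n f)) / (\<alpha> * real Q * real T)
         + 2 * \<alpha> * L / real n * (D + 2 * C * sigma_star n f)
         + 4 * \<alpha>\<^sup>2 * real Q * L\<^sup>2 * D
         + 8 * \<alpha>\<^sup>2 * L\<^sup>2 * (real Q)\<^sup>2 * (3 * L + 2 * C) * sigma_star n f"
    using fedavg_min_grad_bound[of M n Q C D \<alpha> L f g \<xi> x0 T] asm assms by blast
next
  fix M :: "nat \<Rightarrow> 'a measure" and \<xi> :: "nat \<Rightarrow> nat \<Rightarrow> nat \<Rightarrow> nat \<Rightarrow> 'a \<Rightarrow> 's" and \<alpha> :: "nat \<Rightarrow> real"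
  assume asm: "\<forall>T\<ge>1. prob_space (M T) \<and> \<alpha> T > 0 \<and>
          \<alpha> T = 1 / (sqrt (real Q * (L\<^sup>2 + C\<^sup>2) * real T / real n) + gamma_const Q T C L) \<and>
          ABC (M T) n Q f g (\<xi> T)
            (\<lambda>i t l \<omega>. fedavg_local n Q (\<lambda>_. \<alpha> T) g (\<lambda>i t l. \<xi> T i t l \<omega>) x0 i t l) C D"
  let ?r = "\<lambda>T t. \<integral>\<omega>. (norm (grad (avg_obj n f)
      (fedavg n Q (\<lambda>_. \<alpha> T) g (\<lambda>i t l. \<xi> T i t l \<omega>) x0 t)))\<^sup>2 \<partial>(M T)"
  let ?m = "\<lambda>T. MIN t\<in>{0..T-1}. ?r T t"
  define \<delta> where "\<delta> = avg_obj n f x0 - inf_val (avg_obj n f)"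
  define \<sigma> where "\<sigma> = sigma_star n f"
  have bd: "\<forall>i\<in>{1..n}. bdd_below (range (f i))" using assms(5) by auto
  have L: "L \<ge> 0" using assms(1,5) L_smooth_nonneg[of L "f 1"] by simp
  have \<sigma>: "\<sigma> \<ge> 0" unfolding \<sigma>_def by (rule sigma_star_nonneg[OF bd])
  have \<delta>: "\<delta> \<ge> 0" unfolding \<delta>_def using inf_val_le[OF bdd_below_avg_obj[OF bd]] by simp
  have \<alpha>: "\<alpha> T = 1 / tuned_denominator n Q C L T" if "T \<ge> 1" for T
    unfolding tuned_denominator_def using asm that by blast
  (* For L = C = 0 the formula for the stepsize is 1 / 0 = 0, which is not positive. *)
  have pos: "L\<^sup>2 + C\<^sup>2 > 0"
  proof (rule ccontr)
    assume "\<not> L\<^sup>2 + C\<^sup>2 > 0"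
    then have "L = 0" "C = 0" by (simp_all add: sum_power2_gt_zero_iff)
    then have "tuned_denominator n Q C L 1 = 0"
      unfolding tuned_denominator_def gamma_const_def by simp
    then have "\<alpha> 1 = 0" using \<alpha>[of 1] by simp
    moreover have "\<alpha> 1 > 0" using asm by blast
    ultimately show False by simp
  qed
  obtain K where K: "K \<ge> 0" and bound: "\<And>T a. T \<ge> 1 \<Longrightarrow> a = 1 / tuned_denominator n Q C L T \<Longrightarrow>
      12 * \<delta> / (a * real Q * real T) + 2 * a * L / real n * (D + 2 * C * \<sigma>)
        + 4 * a\<^sup>2 * real Q * L\<^sup>2 * D + 8 * a\<^sup>2 * L\<^sup>2 * (real Q)\<^sup>2 * (3 * L + 2 * C) * \<sigma>
      \<le> K * ((\<delta> + D + C * \<sigma>) / sqrt (real T) + \<sigma> / real T)"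
    using tuned_bound_order[OF assms(1-3) L \<delta> assms(4) \<sigma> pos] by blast
  have m0: "0 \<le> ?m T" for T
    by (rule Min.boundedI) auto
  have m_le: "?m T \<le> K * ((\<delta> + D + C * \<sigma>) / sqrt (real T) + \<sigma> / real T)" if T: "T \<ge> 1" for T
  proof -
    have le: "ereal (\<alpha> T) \<le> stepsize_bound n Q T C L"
      unfolding \<alpha>[OF T] by (rule tuned_stepsize_le_bound[OF assms(1,3) L])
    have hyps: "prob_space (M T)" "\<alpha> T > 0" "ABC (M T) n Q f g (\<xi> T)
            (\<lambda>i t l \<omega>. fedavg_local n Q (\<lambda>_. \<alpha> T) g (\<lambda>i t l. \<xi> T i t l \<omega>) x0 i t l) C D"
      using asm T by blast+
    have "?m T \<le> 12 * \<delta> / (\<alpha> T * real Q * real T) + 2 * \<alpha> T * L / real n * (D + 2 * C * \<sigma>)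
        + 4 * (\<alpha> T)\<^sup>2 * real Q * L\<^sup>2 * D + 8 * (\<alpha> T)\<^sup>2 * L\<^sup>2 * (real Q)\<^sup>2 * (3 * L + 2 * C) * \<sigma>"
      unfolding \<delta>_def \<sigma>_def
      by (rule fedavg_min_grad_bound(2)[OF hyps(1) assms(1-4) hyps(2) assms(5) hyps(3) T le])
    also note bound[OF T \<alpha>[OF T]]
    finally show ?thesis .
  qed
  note rate = bigo_rate_from_bound[OF assms(1-3) K \<delta> assms(4) \<sigma> m0 m_le]
  show "(D + C * sigma_star n f > 0 \<longrightarrow>
        ?m \<in> O(\<lambda>T. (D + C * sigma_star n f) / sqrt (real n * real Q * real T)
               + real n * D / real T
               + (1 + C) * sigma_star n f / real T powr (2 / 3))) \<and>
       ?m \<in> O(\<lambda>T. ((avg_obj n f x0 - inf_val (avg_obj n f)) + D + C * sigma_star n f)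
                 / sqrt (real n * real Q * real T)
              + real n * D / real T
              + (1 + C) * ((avg_obj n f x0 - inf_val (avg_obj n f)) + sigma_star n f)
                 / real T powr (2 / 3))"
    using rate unfolding \<delta>_def \<sigma>_def by blast
qed

end
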